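(* Let $(B_t)_{t\in[0,1]}$ be a Brownian motion in $\mathbb{R}$ and, for $N\in\mathbb{N}_0$, let the process $(F_t^N)_{t\in[0,1]}$ be defined by, for $t\in[0,1]$, $$F_t^N=\sqrt{N}\left(B_t-\sum_{n=0}^N\frac{2\sin\left(\left(n+\frac12\right)\pi t\right)}{\left(n+\frac12\right)\pi}\int_0^1\cos\left(\left(n+\tfrac12\right)\pi r\right)\mathrm{d}B_r\right).$$ Then the processes $(F_t^N)_{t\in[0,1]}$ converge in finite dimensional distributions as $N\to\infty$ to the collection $(F_t)_{t\in[0,1]}$ of independent Gaussian random variables with mean zero and variance $$\mathbb{E}\left[(F_t)^2\right]=\begin{cases}\dfrac{1}{\pi^2}&\text{if }t\in(0,1),\\[0.5em]\dfrac{2}{\pi^2}&\text{if }t=1,\\[0.5em]0&\text{if }t=0.\end{cases}$$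
   Context: $\mathbb{N}_0$ denotes the non-negative integers. Brownian motion is standard one-dimensional Brownian motion with $B_0=0$, and the integrals $\int_0^1\cos((n+\frac12)\pi r)\,\mathrm{d}B_r$ are Wiener (It\^o) integrals. Convergence in finite dimensional distributions means that for all $t_1,\dots,t_k\in[0,1]$ the random vectors $(F^N_{t_1},\dots,F^N_{t_k})$ converge in distribution to $(F_{t_1},\dots,F_{t_k})$. A Gaussian random variable with mean zero and variance zero is the constant $0$. *)

theory Defs
  imports "HOL-Probability.Probability"
begin

section \<open>Gaussian random variables and Brownian motion\<close>

text \<open>The second parameter is the mean and the third one is the variance. Since
  \<^const>\<open>normal_density\<close> takes the standard deviation and is degenerate for the value zero,
  the variance zero, where the law is a point mass, is treated separately.\<close>

definition gaussian_rv :: "'a measure \<Rightarrow> ('a \<Rightarrow> real) \<Rightarrow> real \<Rightarrow> real \<Rightarrow> bool" where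
  "gaussian_rv M X m v \<longleftrightarrow>
     X \<in> borel_measurable M \<and>
     (if v = 0 then (AE \<omega> in M. X \<omega> = m)
      else 0 < v \<and> distributed M lborel X (normal_density m (sqrt v)))"

locale brownian_motion = prob_space M for M :: "'a measure" +
  fixes B :: "real \<Rightarrow> 'a \<Rightarrow> real"
  assumes measurable_B: "t \<in> {0..1} \<Longrightarrow> B t \<in> borel_measurable M"
    and start: "AE \<omega> in M. B 0 \<omega> = 0"
    and indep_increments:
      "strict_mono_on {..k} p \<Longrightarrow> p ` {..k} \<subseteq> {0..1} \<Longrightarrow>
         indep_vars (\<lambda>_. borel) (\<lambda>i \<omega>. B (p (Suc i)) \<omega> - B (p i) \<omega>) {..<k::nat}"
    and gaussian_increments:
      "0 \<le> s \<Longrightarrow> s < t \<Longrightarrow> t \<le> 1 \<Longrightarrow> gaussian_rv M (\<lambda>\<omega>. B t \<omega> - B s \<omega>) 0 (t - s)"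
    and continuous_paths: "AE \<omega> in M. continuous_on {0..1} (\<lambda>t. B t \<omega>)"


section \<open>The Wiener integral over the unit interval\<close>

text \<open>A list of triples \<open>(c, a, b)\<close> with \<open>0 \<le> a \<le> b \<le> 1\<close> encodes the step function that is the sum
  of the functions \<open>c\<close> times the indicator of \<open>(a, b]\<close>; the intervals may overlap.\<close>

type_synonym step_fun = "(real \<times> real \<times> real) list"

definition valid_step :: "step_fun \<Rightarrow> bool" where
  "valid_step s \<longleftrightarrow> (\<forall>(c, a, b) \<in> set s. 0 \<le> a \<and> a \<le> b \<and> b \<le> 1)"

definition step_eval :: "step_fun \<Rightarrow> real \<Rightarrow> real" where
  "step_eval s r = (\<Sum>(c, a, b) \<leftarrow> s. c * indicator {a<..b} r)"

definition step_integral :: "(real \<Rightarrow> 'a \<Rightarrow> real) \<Rightarrow> step_fun \<Rightarrow> 'a \<Rightarrow> real" where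
  "step_integral B s \<omega> = (\<Sum>(c, a, b) \<leftarrow> s. c * (B b \<omega> - B a \<omega>))"

text \<open>\<open>I\<close> is a version of the integral of \<open>f\<close> against \<open>B\<close> over \<open>[0,1]\<close> if it is the limit in mean
  square of the integrals of step functions that converge to \<open>f\<close> in \<open>L\<^sup>2[0,1]\<close>.\<close>

definition has_wiener_integral ::
    "'a measure \<Rightarrow> (real \<Rightarrow> 'a \<Rightarrow> real) \<Rightarrow> (real \<Rightarrow> real) \<Rightarrow> ('a \<Rightarrow> real) \<Rightarrow> bool" where
  "has_wiener_integral M B f I \<longleftrightarrow>
     set_borel_measurable lborel {0..1} f \<and> I \<in> borel_measurable M \<and>
     (\<exists>s :: nat \<Rightarrow> step_fun.
        (\<forall>j. valid_step (s j)) \<and>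
        (\<lambda>j. \<integral>\<^sup>+r\<in>{0..1}. ennreal ((f r - step_eval (s j) r)\<^sup>2) \<partial>lborel) \<longlonglongrightarrow> 0 \<and>
        (\<lambda>j. \<integral>\<^sup>+\<omega>. ennreal ((I \<omega> - step_integral B (s j) \<omega>)\<^sup>2) \<partial>M) \<longlonglongrightarrow> 0)"

text \<open>The integral is determined only up to null sets; an arbitrary version is chosen.\<close>

definition wiener_integral ::
    "'a measure \<Rightarrow> (real \<Rightarrow> 'a \<Rightarrow> real) \<Rightarrow> (real \<Rightarrow> real) \<Rightarrow> 'a \<Rightarrow> real" where
  "wiener_integral M B f = (SOME I. has_wiener_integral M B f I)"


section \<open>Convergence in finite dimensional distributions\<close>

text \<open>A vector in \<open>\<real>\<^sup>k\<close> is a function on \<open>{..<k}\<close> that is extensional, that is,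
  \<^const>\<open>undefined\<close> outside of \<open>{..<k}\<close>; these functions form the carrier of
  \<open>\<Pi>\<^sub>M i\<in>{..<k}. borel\<close> and of \<open>powertop_real {..<k}\<close>.\<close>

definition converges_in_distribution ::
    "nat \<Rightarrow> 'a measure \<Rightarrow> (nat \<Rightarrow> 'a \<Rightarrow> nat \<Rightarrow> real) \<Rightarrow> 'b measure \<Rightarrow> ('b \<Rightarrow> nat \<Rightarrow> real) \<Rightarrow> bool" where
  "converges_in_distribution k M X M' Y \<longleftrightarrow>
     (\<forall>N. X N \<in> M \<rightarrow>\<^sub>M (\<Pi>\<^sub>M i\<in>{..<k}. borel)) \<and>
     Y \<in> M' \<rightarrow>\<^sub>M (\<Pi>\<^sub>M i\<in>{..<k}. borel) \<and>
     (\<forall>g. continuous_map (powertop_real {..<k}) euclideanreal g \<and>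
          bounded (g ` topspace (powertop_real {..<k})) \<longrightarrow>
        (\<lambda>N. \<integral>\<omega>. g (X N \<omega>) \<partial>M) \<longlonglongrightarrow> (\<integral>\<omega>. g (Y \<omega>) \<partial>M'))"

definition converges_fdd ::
    "'i set \<Rightarrow> 'a measure \<Rightarrow> (nat \<Rightarrow> 'i \<Rightarrow> 'a \<Rightarrow> real) \<Rightarrow> 'b measure \<Rightarrow> ('i \<Rightarrow> 'b \<Rightarrow> real) \<Rightarrow> bool" where
  "converges_fdd T M X M' Y \<longleftrightarrow>
     (\<forall>(k::nat) t. t \<in> {..<k} \<rightarrow> T \<longrightarrow>
        converges_in_distribution k
          M (\<lambda>N \<omega>. \<lambda>i\<in>{..<k}. X N (t i) \<omega>)
          M' (\<lambda>\<omega>. \<lambda>i\<in>{..<k}. Y (t i) \<omega>))"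


section \<open>The fluctuation processes\<close>

definition fluctuation ::
    "'a measure \<Rightarrow> (real \<Rightarrow> 'a \<Rightarrow> real) \<Rightarrow> nat \<Rightarrow> real \<Rightarrow> 'a \<Rightarrow> real" where
  "fluctuation M B N t \<omega> =
     sqrt (real N) *
       (B t \<omega> -
        (\<Sum>n=0..N. 2 * sin ((real n + 1/2) * pi * t) / ((real n + 1/2) * pi) *
           wiener_integral M B (\<lambda>r. cos ((real n + 1/2) * pi * r)) \<omega>))"

end

theory Submission
  imports Defs "HOL-Real_Asymp.Real_Asymp"
begin

text \<open>The fluctuation \<open>F\<^sup>N\<^sub>t\<close> is \<open>\<surd>N\<close> times the Wiener integral of the function \<open>remainder N t\<close>, the error in
\<open>L\<^sup>2[0,1]\<close> of the expansion of the indicator of \<open>(0,t]\<close> in the orthogonal functions \<open>cos ((n + 1/2) \<pi> r)\<close>.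
The Wiener integral is linear and isometric, and the integral of \<open>g\<close> is centred Gaussian with variance
\<open>\<parallel>g\<parallel>\<^sup>2\<close>. So every linear combination of values of \<open>F\<^sup>N\<close> is a centred Gaussian variable, and its variance is
read off from the covariances \<open>N \<cdot> remainder_kernel N s t\<close>. By orthogonality of the cosines,
\<open>remainder_kernel N s t\<close> is \<open>min s t\<close> minus the sum of \<open>2 sin (\<lambda>\<^sub>n s) sin (\<lambda>\<^sub>n t) / \<lambda>\<^sub>n\<^sup>2\<close> over \<open>n \<le> N\<close>, with
\<open>\<lambda>\<^sub>n = (n + 1/2) \<pi>\<close>.

The limits of these covariances are a fact about one cosine series. The product of two sines is a difference
of cosines, so the kernel is \<open>defect N \<bar>s - t\<bar> - defect N (s + t)\<close>, where \<open>defect N x\<close> is the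
tail after \<open>N\<close> of the series of \<open>cos (\<lambda>\<^sub>n x) / \<lambda>\<^sub>n\<^sup>2\<close>, which sums to \<open>(1 - x) / 2\<close> on \<open>[0,2]\<close>. At \<open>x = 0\<close>
all terms are positive and \<open>N\<close> times the tail tends to \<open>1 / \<pi>\<^sup>2\<close>; at \<open>x = 2\<close> it tends to \<open>-1 / \<pi>\<^sup>2\<close>; for
\<open>0 < x < 2\<close> the oscillation of the cosines makes the tail \<open>O(1/N\<^sup>2)\<close>. Hence the covariances vanish in the limit for
\<open>s \<noteq> t\<close>, and the variances tend to \<open>1 / \<pi>\<^sup>2\<close> in general, to \<open>1 / \<pi>\<^sup>2 + 1 / \<pi>\<^sup>2\<close> at \<open>t = 1\<close> where \<open>s + t = 2\<close>,
and to \<open>1 / \<pi>\<^sup>2 - 1 / \<pi>\<^sup>2\<close> at \<open>t = 0\<close> where \<open>s + t = 0\<close> (lemma \<open>scaled_remainder_kernel_tendsto\<close>).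

Convergence of these Gaussian laws is expressed by the expectations of the waves
\<open>cos (\<Sum>i. \<theta>\<^sub>i x\<^sub>i + c)\<close>, which carry the same information as the characteristic function. That convergence of all
of them implies convergence in distribution of random vectors is Levy's continuity theorem in
several dimensions (\<open>converges_in_distribution_of_waves\<close>); it follows from the one-dimensional theorem, which
gives tightness, and from the Stone-Weierstrass theorem.\<close>

section \<open>Levy continuity theorem for random vectors\<close>

text \<open>Waves with an arbitrary phase cover sines and cosines with a single constructor, and the product of two
of them is a sum of two of them, so that their linear combinations form an algebra.\<close>

inductive trig_poly :: "nat \<Rightarrow> ((nat \<Rightarrow> real) \<Rightarrow> real) \<Rightarrow> bool" for k where
  wave: "trig_poly k (\<lambda>x. a * cos ((\<Sum>i<k. \<theta> i * x i) + c))"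
| add: "trig_poly k f \<Longrightarrow> trig_poly k g \<Longrightarrow> trig_poly k (\<lambda>x. f x + g x)"

lemma trig_poly_const: "trig_poly k (\<lambda>x. c)"
  using trig_poly.wave[of k c "\<lambda>_. 0" 0] by simp

lemma trig_poly_sin:
  assumes "i < k"
  shows "trig_poly k (\<lambda>x. sin (a * x i))"
proof -
  have "(\<Sum>j<k. (if j = i then a else 0) * x j) = a * x i" for x
    using assms by (simp add: if_distrib[of "\<lambda>u. u * _"] sum.delta cong: if_cong)
  with trig_poly.wave[of k 1 "\<lambda>j. if j = i then a else 0" "- (pi/2)"] show ?thesis
    by (simp add: cos_diff)
qed

lemma trig_poly_wave_mult:
  assumes "trig_poly k g"
  shows "trig_poly k (\<lambda>x. a * cos ((\<Sum>i<k. \<theta> i * x i) + c) * g x)"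
  using assms
proof induction
  case (wave b \<phi> d)
  have "a * cos ((\<Sum>i<k. \<theta> i * x i) + c) * (b * cos ((\<Sum>i<k. \<phi> i * x i) + d)) =
      a * b / 2 * cos ((\<Sum>i<k. (\<theta> i + \<phi> i) * x i) + (c + d)) +
      a * b / 2 * cos ((\<Sum>i<k. (\<theta> i - \<phi> i) * x i) + (c - d))" for x
  proof -
    define A B where "A = (\<Sum>i<k. \<theta> i * x i) + c" and "B = (\<Sum>i<k. \<phi> i * x i) + d"
    have "(\<Sum>i<k. (\<theta> i + \<phi> i) * x i) + (c + d) = A + B" "(\<Sum>i<k. (\<theta> i - \<phi> i) * x i) + (c - d) = A - B"
      by (simp_all add: A_def B_def distrib_right left_diff_distrib sum.distrib sum_subtractf)
    moreover have "a * cos A * (b * cos B) = a * b / 2 * cos (A + B) + a * b / 2 * cos (A - B)"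
      by (simp add: cos_add cos_diff field_simps)
    ultimately show ?thesis by (simp only: A_def B_def)
  qed
  then show ?case by (simp only:) (intro trig_poly.intros)
next
  case (add f g)
  then show ?case by (simp add: distrib_left trig_poly.add)
qed

lemma trig_poly_mult:
  assumes "trig_poly k f" "trig_poly k g"
  shows "trig_poly k (\<lambda>x. f x * g x)"
  using assms(1)
  by induction (auto simp: distrib_right intro: trig_poly_wave_mult[OF assms(2)] trig_poly.add)

lemma trig_poly_continuous:
  assumes "trig_poly k f"
  shows "continuous_on UNIV f"
  using assms
  by induction (auto intro!: continuous_intros)

lemma compact_product_intervals: "compact {x :: nat \<Rightarrow> real. \<forall>i. a i \<le> x i \<and> x i \<le> b i}"
proof -
  have "compactin (product_topology (\<lambda>_. euclideanreal) UNIV) (\<Pi>\<^sub>E i\<in>UNIV. {a i..b i})"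
    by (subst compactin_PiE) auto
  also have "(\<Pi>\<^sub>E i\<in>UNIV. {a i..b i}) = {x. \<forall>i. a i \<le> x i \<and> x i \<le> b i}"
    by (auto simp: PiE_def Pi_def)
  finally show ?thesis by (simp add: euclidean_product_topology)
qed

text \<open>An approximation that is uniform on a cube has to stay bounded on the whole space as well, since the laws are
not supported in a cube. To this end Stone-Weierstrass is applied to those trigonometric polynomials that are invariant
under folding every coordinate back into \<open>[-R, R]\<close> along the sine of period \<open>4 R\<close>: such a function takes all
its values on the cube already, and the functions \<open>sin (\<pi> x\<^sub>i / (2 R))\<close> still separate the points of the
cube.\<close>

lemma trig_poly_approximates_on_cube:
  fixes g :: "(nat \<Rightarrow> real) \<Rightarrow> real"
  assumes cont: "continuous_on UNIV g"
    and dep: "\<And>x y. (\<And>i. i < k \<Longrightarrow> x i = y i) \<Longrightarrow> g x = g y"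
    and bound: "\<And>x. \<bar>g x\<bar> \<le> K" and R: "0 < R" and e: "0 < e"
  obtains p where "trig_poly k p" "\<And>x. \<bar>p x\<bar> \<le> K + e"
    "\<And>x. (\<And>i. i < k \<Longrightarrow> \<bar>x i\<bar> \<le> R) \<Longrightarrow> \<bar>g x - p x\<bar> \<le> e"
proof -
  define a where "a = pi / (2 * R)"
  have a: "0 < a" "a * R = pi / 2" using R by (auto simp: a_def)
  define fold where "fold x i = (if i < k then arcsin (sin (a * x i)) / a else 0)" for x :: "nat \<Rightarrow> real" and i
  \<comment> \<open>Coordinates beyond \<open>k\<close> are pinned to \<open>0\<close>, which makes the set compact and lets the first
    \<open>k\<close> coordinates separate its points.\<close>
  define S where "S = {x :: nat \<Rightarrow> real. \<forall>i. (if i < k then - R else 0) \<le> x i \<and> x i \<le> (if i < k then R else 0)}"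
  have fold_S: "fold x \<in> S" for x
  proof -
    have "- R \<le> arcsin y / a \<and> arcsin y / a \<le> R" if "-1 \<le> y" "y \<le> 1" for y
      using arcsin_bounded[OF that] a by (auto simp: pos_le_divide_eq pos_divide_le_eq mult.commute)
    then show ?thesis by (auto simp: S_def fold_def)
  qed
  have fold_id: "fold x = x" if "x \<in> S" for x
  proof
    fix i
    show "fold x i = x i"
    proof (cases "i < k")
      case True
      with that have "- R \<le> x i" "x i \<le> R" by (auto simp: S_def split: if_splits)
      then have "- (pi/2) \<le> a * x i" "a * x i \<le> pi/2"
        using mult_left_mono[of "- R" "x i" a] mult_left_mono[of "x i" R a] a by auto
      with True a show ?thesis by (simp add: fold_def arcsin_sin)
    next
      case False
      with that show ?thesis by (auto simp: fold_def S_def dest: spec[of _ i])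
    qed
  qed
  define P where "P p \<longleftrightarrow> trig_poly k p \<and> (\<forall>x. p x = p (fold x))" for p
  have "\<exists>p. P p \<and> (\<forall>x\<in>S. \<bar>g x - p x\<bar> < e)"
  proof (rule Stone_Weierstrass_HOL)
    show "compact S" unfolding S_def by (rule compact_product_intervals)
    show "continuous_on S g" using cont continuous_on_subset by blast
    show "continuous_on S f" if "P f" for f
      using that trig_poly_continuous[of k f] continuous_on_subset unfolding P_def by blast
    show "P (\<lambda>x. c)" for c by (simp add: P_def trig_poly_const)
    show "P (\<lambda>x. f x + g x)" if "P f \<and> P g" for f g
      using that by (auto simp: P_def intro: trig_poly.add)
    show "P (\<lambda>x. f x * g x)" if "P f \<and> P g" for f g
      using that by (auto simp: P_def intro: trig_poly_mult)
    show "\<exists>f. P f \<and> f x \<noteq> f y" if "x \<in> S \<and> y \<in> S \<and> x \<noteq> y" for x y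
    proof -
      from that have xy: "fold x \<noteq> fold y" by (simp add: fold_id)
      then obtain i where i: "fold x i \<noteq> fold y i" by blast
      then have "i < k" by (auto simp: fold_def split: if_splits)
      moreover have "sin (a * x i) \<noteq> sin (a * y i)" using i by (auto simp: fold_def split: if_splits)
      moreover have "P (\<lambda>x. sin (a * x i))"
        using \<open>i < k\<close> a trig_poly_sin[of i k a] by (auto simp: P_def fold_def)
      ultimately show ?thesis by blast
    qed
  qed (use e in auto)
  then obtain p where p: "trig_poly k p" "\<And>x. p x = p (fold x)" and close: "\<And>x. x \<in> S \<Longrightarrow> \<bar>g x - p x\<bar> < e"
    by (auto simp: P_def)
  show ?thesis
  proof (rule that[OF p(1)])
    fix x
    show "\<bar>p x\<bar> \<le> K + e" using close[OF fold_S[of x]] bound[of "fold x"] p(2)[of x] by linarith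
  next
    fix x assume x: "\<And>i. i < k \<Longrightarrow> \<bar>x i\<bar> \<le> R"
    define y where "y i = (if i < k then x i else 0)" for i
    have y: "y \<in> S" using x by (auto simp: S_def y_def abs_le_iff minus_le_iff)
    have "fold x = fold y" by (auto simp: fold_def y_def)
    then have "p x = p y" using p(2)[of x] p(2)[of y] by simp
    moreover have "g x = g y" by (rule dep) (simp add: y_def)
    ultimately show "\<bar>g x - p x\<bar> \<le> e" using close[OF y] by simp
  qed
qed

text \<open>A bounded continuous function that is \<open>0\<close> on \<open>[-R, R]\<close> and \<open>1\<close> outside of \<open>[-R - 1, R + 1]\<close>. Its expectation
bounds the mass outside of the larger interval, and it converges under convergence in distribution.\<close>

definition excess :: "real \<Rightarrow> real \<Rightarrow> real" where
  "excess R x = min 1 (max 0 (\<bar>x\<bar> - R))"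

lemma excess_bounds: "0 \<le> excess R x" "excess R x \<le> 1"
  by (auto simp: excess_def)

lemma excess_measurable [measurable]: "excess R \<in> borel_measurable borel"
  unfolding excess_def by measurable

lemma (in prob_space) expectation_excess_tendsto_0:
  assumes [measurable]: "X \<in> borel_measurable M"
  shows "(\<lambda>n. expectation (\<lambda>\<omega>. excess (real n) (X \<omega>))) \<longlonglongrightarrow> 0"
proof -
  have "(\<lambda>n. excess (real n) x) \<longlonglongrightarrow> 0" for x
  proof (rule tendsto_eventually)
    show "\<forall>\<^sub>F n in sequentially. excess (real n) x = 0"
      using eventually_ge_at_top[of "nat \<lceil>\<bar>x\<bar>\<rceil>"]
    proof eventually_elim
      case (elim n)
      then have "\<bar>x\<bar> \<le> real n" by linarith
      then show ?case by (simp add: excess_def)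
    qed
  qed
  then have "(\<lambda>n. expectation (\<lambda>\<omega>. excess (real n) (X \<omega>))) \<longlonglongrightarrow> expectation (\<lambda>\<omega>. 0)"
    by (intro integral_dominated_convergence[where w = "\<lambda>_. 1"]) (auto simp: excess_bounds)
  then show ?thesis by simp
qed

text \<open>The waves with the phases \<open>0\<close> and \<open>-\<pi>/2\<close> are the real and the imaginary part of the characteristic function,
so this is an instance of the one-dimensional continuity theorem. Applied to each coordinate, it replaces a tightness
assumption.\<close>

lemma expectation_excess_tendsto:
  assumes "prob_space M" "prob_space M'"
    and X: "\<And>N. X N \<in> borel_measurable M" and Y: "Y \<in> borel_measurable M'"
    and conv: "\<And>\<theta> c. (\<lambda>N. \<integral>\<omega>. cos (\<theta> * X N \<omega> + c) \<partial>M) \<longlonglongrightarrow> (\<integral>\<omega>. cos (\<theta> * Y \<omega> + c) \<partial>M')"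
  shows "(\<lambda>N. \<integral>\<omega>. excess R (X N \<omega>) \<partial>M) \<longlonglongrightarrow> (\<integral>\<omega>. excess R (Y \<omega>) \<partial>M')"
proof -
  have char_eq: "char (distr M borel Z) \<theta> = complex_of_real (\<integral>\<omega>. cos (\<theta> * Z \<omega> + 0) \<partial>M) + \<i> * complex_of_real (\<integral>\<omega>. cos (\<theta> * Z \<omega> + (- pi / 2)) \<partial>M)"
    if "prob_space M" and [measurable]: "Z \<in> borel_measurable M" for M :: "'x measure" and Z \<theta>
  proof -
    interpret prob_space M by fact
    have i: "integrable M (\<lambda>\<omega>. cos (\<theta> * Z \<omega> + c))" for c
      by (rule integrable_const_bound[where B = 1]) auto
    have "char (distr M borel Z) \<theta> = (\<integral>\<omega>. iexp (\<theta> * Z \<omega>) \<partial>M)"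
      by (simp add: char_def integral_distr)
    also have "\<dots> = (\<integral>\<omega>. complex_of_real (cos (\<theta> * Z \<omega> + 0)) + \<i> * complex_of_real (cos (\<theta> * Z \<omega> + (- pi / 2))) \<partial>M)"
      by (intro Bochner_Integration.integral_cong refl) (simp add: complex_eq_iff Re_exp Im_exp cos_diff)
    also have "\<dots> = complex_of_real (\<integral>\<omega>. cos (\<theta> * Z \<omega> + 0) \<partial>M) + \<i> * complex_of_real (\<integral>\<omega>. cos (\<theta> * Z \<omega> + (- pi / 2)) \<partial>M)"
      using i[of 0] i[of "- pi/2"] by (subst Bochner_Integration.integral_add) auto
    finally show ?thesis .
  qed
  have "weak_conv_m (\<lambda>N. distr M borel (X N)) (distr M' borel Y)"
  proof (rule levy_continuity)
    show "real_distribution (distr M borel (X N))" for N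
      using prob_space.real_distribution_distr[OF assms(1) X] .
    show "real_distribution (distr M' borel Y)"
      using prob_space.real_distribution_distr[OF assms(2) Y] .
    show "(\<lambda>N. char (distr M borel (X N)) \<theta>) \<longlonglongrightarrow> char (distr M' borel Y) \<theta>" for \<theta>
      unfolding char_eq[OF assms(1) X] char_eq[OF assms(2) Y]
      by (intro tendsto_intros conv)
  qed
  then have "(\<lambda>N. integral\<^sup>L (distr M borel (X N)) (excess R)) \<longlonglongrightarrow> integral\<^sup>L (distr M' borel Y) (excess R)"
  proof (rule weak_conv_imp_integral_bdd_continuous_conv[rotated 2])
    show "real_distribution (distr M borel (X N))" for N
      using prob_space.real_distribution_distr[OF assms(1) X] .
    show "real_distribution (distr M' borel Y)"
      using prob_space.real_distribution_distr[OF assms(2) Y] .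
    show "isCont (excess R) x" for x
      unfolding excess_def by (intro continuous_intros)
    show "norm (excess R x) \<le> 1" for x
      using excess_bounds[of R x] by simp
  qed
  then show ?thesis using X Y by (simp add: integral_distr)
qed

lemma trig_poly_expectation:
  assumes "prob_space M" and X: "\<And>i. i < k \<Longrightarrow> (\<lambda>\<omega>. X \<omega> i) \<in> borel_measurable M"
    and "trig_poly k p"
  shows "integrable M (\<lambda>\<omega>. p (X \<omega>))"
  using assms(3)
proof induction
  case (wave a \<theta> c)
  interpret prob_space M by fact
  note [measurable] = X
  have "integrable M (\<lambda>\<omega>. cos ((\<Sum>i<k. \<theta> i * X \<omega> i) + c))"
    by (rule integrable_const_bound[where B = 1]) auto
  then show ?case by simp
qed simp

lemma trig_poly_expectation_tendsto:
  fixes X :: "nat \<Rightarrow> 'a \<Rightarrow> nat \<Rightarrow> real"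
  assumes "prob_space M" "prob_space M'"
    and X: "\<And>N i. i < k \<Longrightarrow> (\<lambda>\<omega>. X N \<omega> i) \<in> borel_measurable M"
    and Y: "\<And>i. i < k \<Longrightarrow> (\<lambda>\<omega>. Y \<omega> i) \<in> borel_measurable M'"
    and conv: "\<And>\<theta> c. (\<lambda>N. \<integral>\<omega>. cos ((\<Sum>i<k. \<theta> i * X N \<omega> i) + c) \<partial>M)
        \<longlonglongrightarrow> (\<integral>\<omega>. cos ((\<Sum>i<k. \<theta> i * Y \<omega> i) + c) \<partial>M')"
    and "trig_poly k p"
  shows "(\<lambda>N. \<integral>\<omega>. p (X N \<omega>) \<partial>M) \<longlonglongrightarrow> (\<integral>\<omega>. p (Y \<omega>) \<partial>M')"
  using assms(6)
proof induction
  case (wave a \<theta> c)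
  then show ?case using conv[of \<theta> c] by (auto intro: tendsto_intros)
next
  case (add f g)
  have "integrable M (\<lambda>\<omega>. q (X N \<omega>))" "integrable M' (\<lambda>\<omega>. q (Y \<omega>))" if "trig_poly k q" for q N
    using trig_poly_expectation[OF assms(1) X that] trig_poly_expectation[OF assms(2) Y that] by auto
  with add show ?case by (simp add: tendsto_add)
qed

text \<open>On a large cube \<open>g\<close> is replaced by a trigonometric polynomial; outside of the cube both functions are
bounded, and the error is controlled by the expected \<open>excess\<close> of the coordinates, which is small for the limit
and hence in the limit for the sequence.\<close>

lemma expectation_tendsto_of_waves:
  fixes X :: "nat \<Rightarrow> 'a \<Rightarrow> nat \<Rightarrow> real" and Y :: "'b \<Rightarrow> nat \<Rightarrow> real"
    and g :: "(nat \<Rightarrow> real) \<Rightarrow> real"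
  assumes M: "prob_space M" and M': "prob_space M'"
    and X: "\<And>N i. i < k \<Longrightarrow> (\<lambda>\<omega>. X N \<omega> i) \<in> borel_measurable M"
    and Y: "\<And>i. i < k \<Longrightarrow> (\<lambda>\<omega>. Y \<omega> i) \<in> borel_measurable M'"
    and conv: "\<And>\<theta> c. (\<lambda>N. \<integral>\<omega>. cos ((\<Sum>i<k. \<theta> i * X N \<omega> i) + c) \<partial>M)
        \<longlonglongrightarrow> (\<integral>\<omega>. cos ((\<Sum>i<k. \<theta> i * Y \<omega> i) + c) \<partial>M')"
    and cont: "continuous_on UNIV g"
    and dep: "\<And>x y. (\<And>i. i < k \<Longrightarrow> x i = y i) \<Longrightarrow> g x = g y"
    and bound: "\<And>x. \<bar>g x\<bar> \<le> K"
  shows "(\<lambda>N. \<integral>\<omega>. g (X N \<omega>) \<partial>M) \<longlonglongrightarrow> (\<integral>\<omega>. g (Y \<omega>) \<partial>M')"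
proof (rule tendstoI)
  fix e :: real assume e: "0 < e"
  have K: "0 \<le> K" using bound[of undefined] by linarith
  define C where "C = 2 * K + 1"
  have C: "0 < C" using K by (simp add: C_def)
  define \<delta> where "\<delta> = min 1 (e / 8)"
  have \<delta>: "0 < \<delta>" "\<delta> \<le> 1" "\<delta> \<le> e / 8" using e by (auto simp: \<delta>_def)
  have "(\<lambda>n. C * (\<Sum>i<k. \<integral>\<omega>. excess (real n) (Y \<omega> i) \<partial>M')) \<longlonglongrightarrow> C * (\<Sum>i<k. 0)"
    using Y by (intro tendsto_intros prob_space.expectation_excess_tendsto_0[OF M']) auto
  then have "\<forall>\<^sub>F n in sequentially. C * (\<Sum>i<k. \<integral>\<omega>. excess (real n) (Y \<omega> i) \<partial>M') < e / 8"
    using e by (intro order_tendstoD) auto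
  then obtain n where n: "C * (\<Sum>i<k. \<integral>\<omega>. excess (real n) (Y \<omega> i) \<partial>M') < e / 8"
    by (auto simp: eventually_sequentially)
  define R where "R = real n"
  obtain p where p: "trig_poly k p" "\<And>x. \<bar>p x\<bar> \<le> K + \<delta>"
      "\<And>x. (\<And>i. i < k \<Longrightarrow> \<bar>x i\<bar> \<le> R + 1) \<Longrightarrow> \<bar>g x - p x\<bar> \<le> \<delta>"
    using trig_poly_approximates_on_cube[OF cont dep bound _ \<delta>(1), of k "R + 1"]
    by (auto simp: R_def)
  have pointwise: "\<bar>g x - p x\<bar> \<le> \<delta> + C * (\<Sum>i<k. excess R (x i))" for x
  proof (cases "\<forall>i<k. \<bar>x i\<bar> \<le> R + 1")
    case True
    have "0 \<le> C * (\<Sum>i<k. excess R (x i))"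
      using C by (intro mult_nonneg_nonneg sum_nonneg excess_bounds) auto
    with p(3)[of x] True show ?thesis by fastforce
  next
    case False
    then obtain i where i: "i < k" "\<bar>x i\<bar> > R + 1" by force
    have "1 \<le> excess R (x i)" using i(2) by (auto simp: excess_def)
    also have "\<dots> \<le> (\<Sum>i<k. excess R (x i))"
      using i(1) by (intro member_le_sum excess_bounds) auto
    finally have "C * 1 \<le> C * (\<Sum>i<k. excess R (x i))" using C by (intro mult_left_mono) auto
    moreover have "\<bar>g x - p x\<bar> \<le> 2 * K + \<delta>" using bound[of x] p(2)[of x] by linarith
    ultimately show ?thesis using \<delta> by (simp add: C_def)
  qed
  have approx: "\<bar>(\<integral>\<omega>. g (Z \<omega>) \<partial>L) - (\<integral>\<omega>. p (Z \<omega>) \<partial>L)\<bar> \<le> \<delta> + C * (\<Sum>i<k. \<integral>\<omega>. excess R (Z \<omega> i) \<partial>L)"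
    if L: "prob_space L" and Z: "\<And>i. i < k \<Longrightarrow> (\<lambda>\<omega>. Z \<omega> i) \<in> borel_measurable L"
    for L :: "'x measure" and Z
  proof -
    interpret prob_space L by fact
    have "(\<lambda>\<omega> i. if i < k then Z \<omega> i else 0) \<in> borel_measurable L"
    proof (rule measurable_coordinatewise_then_product)
      show "(\<lambda>\<omega>. if i < k then Z \<omega> i else 0) \<in> borel_measurable L" for i
        using Z by (cases "i < k") auto
    qed
    from measurable_compose[OF this borel_measurable_continuous_onI[OF cont]]
    have "(\<lambda>\<omega>. g (\<lambda>i. if i < k then Z \<omega> i else 0)) \<in> borel_measurable L" .
    also have "(\<lambda>\<omega>. g (\<lambda>i. if i < k then Z \<omega> i else 0)) = (\<lambda>\<omega>. g (Z \<omega>))"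
      by (intro ext dep) simp
    finally have "(\<lambda>\<omega>. g (Z \<omega>)) \<in> borel_measurable L" .
    then have ig: "integrable L (\<lambda>\<omega>. g (Z \<omega>))"
      by (intro integrable_const_bound[where B = K]) (auto simp: bound)
    have ip: "integrable L (\<lambda>\<omega>. p (Z \<omega>))" by (rule trig_poly_expectation[OF L Z p(1)])
    have ie: "integrable L (\<lambda>\<omega>. excess R (Z \<omega> i))" if "i < k" for i
      using measurable_compose[OF Z[OF that] excess_measurable]
      by (intro integrable_const_bound[where B = 1]) (auto simp: excess_bounds)
    have iS: "integrable L (\<lambda>\<omega>. C * (\<Sum>i<k. excess R (Z \<omega> i)))"
      using ie by (intro integrable_mult_right Bochner_Integration.integrable_sum) auto
    have iC: "integrable L (\<lambda>\<omega>. \<delta> + C * (\<Sum>i<k. excess R (Z \<omega> i)))"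
      by (intro Bochner_Integration.integrable_add iS integrable_const)
    have "\<bar>(\<integral>\<omega>. g (Z \<omega>) \<partial>L) - (\<integral>\<omega>. p (Z \<omega>) \<partial>L)\<bar> = \<bar>\<integral>\<omega>. g (Z \<omega>) - p (Z \<omega>) \<partial>L\<bar>"
      using ig ip by simp
    also have "\<dots> \<le> (\<integral>\<omega>. \<bar>g (Z \<omega>) - p (Z \<omega>)\<bar> \<partial>L)"
      by (rule integral_abs_bound)
    also have "\<dots> \<le> (\<integral>\<omega>. \<delta> + C * (\<Sum>i<k. excess R (Z \<omega> i)) \<partial>L)"
      using ig ip iC by (intro integral_mono pointwise) auto
    also have "\<dots> = \<delta> + C * (\<Sum>i<k. \<integral>\<omega>. excess R (Z \<omega> i) \<partial>L)"
      using iS ie by (simp add: prob_space Bochner_Integration.integral_sum)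
    finally show ?thesis .
  qed
  define T where "T = C * (\<Sum>i<k. \<integral>\<omega>. excess R (Y \<omega> i) \<partial>M')"
  define D where "D N = (\<delta> + C * (\<Sum>i<k. \<integral>\<omega>. excess R (X N \<omega> i) \<partial>M)) +
      \<bar>(\<integral>\<omega>. p (X N \<omega>) \<partial>M) - (\<integral>\<omega>. p (Y \<omega>) \<partial>M')\<bar> + (\<delta> + T)" for N
  have single: "(\<lambda>N. \<integral>\<omega>. cos (\<theta> * X N \<omega> i + c) \<partial>M) \<longlonglongrightarrow> (\<integral>\<omega>. cos (\<theta> * Y \<omega> i + c) \<partial>M')" if "i < k" for i \<theta> c
    using conv[of "\<lambda>j. if j = i then \<theta> else 0" c] that
    by (simp add: if_distrib[of "\<lambda>u. u * _"] sum.delta cong: if_cong)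
  have "D \<longlonglongrightarrow> (\<delta> + T) + \<bar>(\<integral>\<omega>. p (Y \<omega>) \<partial>M') - (\<integral>\<omega>. p (Y \<omega>) \<partial>M')\<bar> + (\<delta> + T)"
    unfolding D_def T_def
    by (intro tendsto_intros expectation_excess_tendsto[OF M M'] single X Y
        trig_poly_expectation_tendsto[OF M M' X Y conv p(1)]) auto
  moreover have "(\<delta> + T) + \<bar>(\<integral>\<omega>. p (Y \<omega>) \<partial>M') - (\<integral>\<omega>. p (Y \<omega>) \<partial>M')\<bar> + (\<delta> + T) < e"
    using n \<delta> e unfolding T_def R_def by linarith
  ultimately have "\<forall>\<^sub>F N in sequentially. D N < e" by (rule order_tendstoD)
  then show "\<forall>\<^sub>F N in sequentially. dist (\<integral>\<omega>. g (X N \<omega>) \<partial>M) (\<integral>\<omega>. g (Y \<omega>) \<partial>M') < e"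
  proof eventually_elim
    case (elim N)
    have "\<bar>(\<integral>\<omega>. g (X N \<omega>) \<partial>M) - (\<integral>\<omega>. p (X N \<omega>) \<partial>M)\<bar> \<le> \<delta> + C * (\<Sum>i<k. \<integral>\<omega>. excess R (X N \<omega> i) \<partial>M)"
      by (rule approx[OF M X])
    moreover have "\<bar>(\<integral>\<omega>. g (Y \<omega>) \<partial>M') - (\<integral>\<omega>. p (Y \<omega>) \<partial>M')\<bar> \<le> \<delta> + T"
      unfolding T_def by (rule approx[OF M' Y])
    ultimately have "\<bar>(\<integral>\<omega>. g (X N \<omega>) \<partial>M) - (\<integral>\<omega>. g (Y \<omega>) \<partial>M')\<bar> \<le> D N"
      unfolding D_def by linarith
    with elim show ?case by (simp add: dist_real_def)
  qed
qed

text \<open>A bounded continuous function on \<open>\<real>\<^sup>k\<close> is composed with the restriction to \<open>{..<k}\<close>, which makes it a continuous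
function on all sequences that depends on \<open>k\<close> coordinates only. There the product topology and its Borel
sets belong to the type itself.\<close>

theorem converges_in_distribution_of_waves:
  fixes X :: "nat \<Rightarrow> 'a \<Rightarrow> nat \<Rightarrow> real" and Y :: "'b \<Rightarrow> nat \<Rightarrow> real"
  assumes M: "prob_space M" and M': "prob_space M'"
    and X: "\<And>N i. i < k \<Longrightarrow> (\<lambda>\<omega>. X N \<omega> i) \<in> borel_measurable M"
    and Y: "\<And>i. i < k \<Longrightarrow> (\<lambda>\<omega>. Y \<omega> i) \<in> borel_measurable M'"
    and conv: "\<And>\<theta> c. (\<lambda>N. \<integral>\<omega>. cos ((\<Sum>i<k. \<theta> i * X N \<omega> i) + c) \<partial>M)
        \<longlonglongrightarrow> (\<integral>\<omega>. cos ((\<Sum>i<k. \<theta> i * Y \<omega> i) + c) \<partial>M')"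
  shows "converges_in_distribution k M (\<lambda>N \<omega>. \<lambda>i\<in>{..<k}. X N \<omega> i) M' (\<lambda>\<omega>. \<lambda>i\<in>{..<k}. Y \<omega> i)"
  unfolding converges_in_distribution_def
proof (intro conjI allI impI)
  show "(\<lambda>\<omega>. \<lambda>i\<in>{..<k}. X N \<omega> i) \<in> M \<rightarrow>\<^sub>M (\<Pi>\<^sub>M i\<in>{..<k}. borel)" for N
    using X by (intro measurable_restrict) auto
  show "(\<lambda>\<omega>. \<lambda>i\<in>{..<k}. Y \<omega> i) \<in> M' \<rightarrow>\<^sub>M (\<Pi>\<^sub>M i\<in>{..<k}. borel)"
    using Y by (intro measurable_restrict) auto
next
  fix g :: "(nat \<Rightarrow> real) \<Rightarrow> real"
  assume g: "continuous_map (powertop_real {..<k}) euclideanreal g \<and>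
    bounded (g ` topspace (powertop_real {..<k}))"
  define h where "h x = g (\<lambda>i\<in>{..<k}. x i)" for x
  have "continuous_map (powertop_real UNIV) (powertop_real {..<k}) (\<lambda>x. \<lambda>i\<in>{..<k}. x i)"
    by (auto simp: continuous_map_componentwise intro: continuous_map_product_projection)
  from continuous_map_compose[OF this conjunct1[OF g]] have cont: "continuous_on UNIV h"
    by (simp add: h_def comp_def euclidean_product_topology)
  from g obtain K where "\<And>x. x \<in> topspace (powertop_real {..<k}) \<Longrightarrow> \<bar>g x\<bar> \<le> K"
    by (auto simp: bounded_iff)
  then have bound: "\<bar>h x\<bar> \<le> K" for x by (simp add: h_def)
  have dep: "h x = h y" if "\<And>i. i < k \<Longrightarrow> x i = y i" for x y
    using that by (auto simp: h_def intro!: arg_cong[of _ _ g])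
  show "(\<lambda>N. \<integral>\<omega>. g (\<lambda>i\<in>{..<k}. X N \<omega> i) \<partial>M) \<longlonglongrightarrow> (\<integral>\<omega>. g (\<lambda>i\<in>{..<k}. Y \<omega> i) \<partial>M')"
    using expectation_tendsto_of_waves[OF M M' X Y conv cont dep bound] by (simp add: h_def)
qed

section \<open>Mean square convergence and second moments\<close>

lemma mean_square_lincomb_tendsto_0:
  fixes u v :: "nat \<Rightarrow> 'a \<Rightarrow> real"
  assumes [measurable]: "\<And>j. u j \<in> borel_measurable M" "\<And>j. v j \<in> borel_measurable M"
    and u: "(\<lambda>j. \<integral>\<^sup>+x. ennreal ((u j x)\<^sup>2) \<partial>M) \<longlonglongrightarrow> 0"
    and v: "(\<lambda>j. \<integral>\<^sup>+x. ennreal ((v j x)\<^sup>2) \<partial>M) \<longlonglongrightarrow> 0"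
  shows "(\<lambda>j. \<integral>\<^sup>+x. ennreal ((\<alpha> * u j x + \<beta> * v j x)\<^sup>2) \<partial>M) \<longlonglongrightarrow> 0"
proof (rule tendsto_sandwich[OF _ _ tendsto_const])
  define bnd where "bnd j = ennreal (2 * \<alpha>\<^sup>2) * (\<integral>\<^sup>+x. ennreal ((u j x)\<^sup>2) \<partial>M) +
      ennreal (2 * \<beta>\<^sup>2) * (\<integral>\<^sup>+x. ennreal ((v j x)\<^sup>2) \<partial>M)" for j
  have "(\<integral>\<^sup>+x. ennreal ((\<alpha> * u j x + \<beta> * v j x)\<^sup>2) \<partial>M) \<le> bnd j" for j
  proof -
    have "(\<alpha> * a + \<beta> * b)\<^sup>2 \<le> 2 * \<alpha>\<^sup>2 * a\<^sup>2 + 2 * \<beta>\<^sup>2 * b\<^sup>2" for a b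
      using zero_le_power2[of "\<alpha> * a - \<beta> * b"] by (simp add: power2_eq_square algebra_simps)
    then have "(\<integral>\<^sup>+x. ennreal ((\<alpha> * u j x + \<beta> * v j x)\<^sup>2) \<partial>M) \<le>
        (\<integral>\<^sup>+x. ennreal (2 * \<alpha>\<^sup>2) * ennreal ((u j x)\<^sup>2) + ennreal (2 * \<beta>\<^sup>2) * ennreal ((v j x)\<^sup>2) \<partial>M)"
      by (intro nn_integral_mono) (simp add: ennreal_mult[symmetric] ennreal_plus[symmetric] del: ennreal_plus)
    also have "\<dots> = bnd j" unfolding bnd_def by (simp add: nn_integral_add nn_integral_cmult)
    finally show ?thesis .
  qed
  then show "\<forall>\<^sub>F j in sequentially. (\<integral>\<^sup>+x. ennreal ((\<alpha> * u j x + \<beta> * v j x)\<^sup>2) \<partial>M) \<le> bnd j"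
    by simp
  have "bnd \<longlonglongrightarrow> ennreal (2 * \<alpha>\<^sup>2) * 0 + ennreal (2 * \<beta>\<^sup>2) * 0"
    unfolding bnd_def by (intro tendsto_add ennreal_tendsto_cmult u v) auto
  then show "bnd \<longlonglongrightarrow> 0" by simp
qed simp

text \<open>Instead of the Cauchy-Schwarz inequality, the cross term in \<open>x\<^sup>2 - z\<^sup>2\<close> is estimated by
\<open>2 z (z - x) \<le> \<eta> z\<^sup>2 + (z - x)\<^sup>2 / \<eta>\<close> with a small weight \<open>\<eta>\<close>.\<close>

lemma integral_square_tendsto:
  fixes X :: "nat \<Rightarrow> 'a \<Rightarrow> real"
  assumes [measurable]: "\<And>j. X j \<in> borel_measurable M" "Z \<in> borel_measurable M"
    and int: "\<And>j. integrable M (\<lambda>x. (X j x)\<^sup>2)"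
    and conv: "(\<lambda>j. \<integral>\<^sup>+x. ennreal ((Z x - X j x)\<^sup>2) \<partial>M) \<longlonglongrightarrow> 0"
  shows "(\<lambda>j. \<integral>x. (X j x)\<^sup>2 \<partial>M) \<longlonglongrightarrow> (\<integral>x. (Z x)\<^sup>2 \<partial>M)"
proof -
  have split: "(x + y)\<^sup>2 \<le> 2 * x\<^sup>2 + 2 * y\<^sup>2" for x y :: real
    using zero_le_power2[of "x - y"] by (simp add: power2_eq_square algebra_simps)
  have "\<forall>\<^sub>F j in sequentially. (\<integral>\<^sup>+x. ennreal ((Z x - X j x)\<^sup>2) \<partial>M) < 1"
    using conv by (rule order_tendstoD) simp
  then obtain j0 where "(\<integral>\<^sup>+x. ennreal ((Z x - X j0 x)\<^sup>2) \<partial>M) < 1"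
    by (auto simp: eventually_sequentially)
  then have "integrable M (\<lambda>x. (Z x - X j0 x)\<^sup>2)"
    by (intro integrableI_nonneg) (auto intro: less_trans[OF _ ennreal_one_less_top])
  then have "integrable M (\<lambda>x. 2 * (Z x - X j0 x)\<^sup>2 + 2 * (X j0 x)\<^sup>2)"
    using int by auto
  then have intZ: "integrable M (\<lambda>x. (Z x)\<^sup>2)"
    by (rule Bochner_Integration.integrable_bound) (use split[of "Z x - X j0 x" "X j0 x" for x] in auto)
  have intD: "integrable M (\<lambda>x. (Z x - X j x)\<^sup>2)" for j
  proof (rule Bochner_Integration.integrable_bound)
    show "integrable M (\<lambda>x. 2 * (Z x)\<^sup>2 + 2 * (X j x)\<^sup>2)" using int intZ by auto
    show "AE x in M. norm ((Z x - X j x)\<^sup>2) \<le> norm (2 * (Z x)\<^sup>2 + 2 * (X j x)\<^sup>2)"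
      using split[of "Z x" "- X j x" for x] by simp
  qed auto
  define d where "d j = (\<integral>x. (Z x - X j x)\<^sup>2 \<partial>M)" for j
  have "(\<lambda>j. ennreal (d j)) \<longlonglongrightarrow> ennreal 0"
    using conv by (simp add: d_def nn_integral_eq_integral[OF intD])
  then have d: "d \<longlonglongrightarrow> 0"
    by (subst (asm) tendsto_ennreal_iff) (auto simp: d_def)
  define A where "A = (\<integral>x. (Z x)\<^sup>2 \<partial>M)"
  have A: "0 \<le> A" by (simp add: A_def)
  have key: "\<bar>(\<integral>x. (X j x)\<^sup>2 \<partial>M) - A\<bar> \<le> (1 + 1/\<eta>) * d j + \<eta> * A" if \<eta>: "0 < \<eta>" for \<eta> j
  proof -
    have pointwise: "\<bar>x\<^sup>2 - z\<^sup>2\<bar> \<le> (1 + 1/\<eta>) * (z - x)\<^sup>2 + \<eta> * z\<^sup>2" for x z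
    proof -
      have "0 \<le> (\<eta> * z + (z - x))\<^sup>2 / \<eta>" "0 \<le> (\<eta> * z - (z - x))\<^sup>2 / \<eta>" using \<eta> by auto
      then have "2 * z * (z - x) \<le> (z - x)\<^sup>2 / \<eta> + \<eta> * z\<^sup>2" "- (2 * z * (z - x)) \<le> (z - x)\<^sup>2 / \<eta> + \<eta> * z\<^sup>2"
        using \<eta> by (simp_all add: power2_eq_square field_simps)
      moreover have "x\<^sup>2 - z\<^sup>2 = (z - x)\<^sup>2 - 2 * z * (z - x)"
        by (simp add: power2_eq_square algebra_simps)
      moreover have "(1 + 1/\<eta>) * (z - x)\<^sup>2 = (z - x)\<^sup>2 + (z - x)\<^sup>2 / \<eta>"
        by (simp add: distrib_right)
      ultimately show ?thesis using zero_le_power2[of "z - x"] unfolding abs_le_iff by linarith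
    qed
    have "\<bar>(\<integral>x. (X j x)\<^sup>2 \<partial>M) - A\<bar> = \<bar>\<integral>x. (X j x)\<^sup>2 - (Z x)\<^sup>2 \<partial>M\<bar>"
      using int intZ by (simp add: A_def)
    also have "\<dots> \<le> (\<integral>x. \<bar>(X j x)\<^sup>2 - (Z x)\<^sup>2\<bar> \<partial>M)" by (rule integral_abs_bound)
    also have "\<dots> \<le> (\<integral>x. (1 + 1/\<eta>) * (Z x - X j x)\<^sup>2 + \<eta> * (Z x)\<^sup>2 \<partial>M)"
      using int intZ intD by (intro integral_mono pointwise) auto
    also have "\<dots> = (1 + 1/\<eta>) * d j + \<eta> * A"
      using intZ intD by (simp add: d_def A_def)
    finally show ?thesis .
  qed
  show ?thesis
  proof (rule tendstoI)
    fix e :: real assume e: "0 < e"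
    \<comment> \<open>Chosen so that \<open>\<eta> A \<le> e / 2\<close>; the summand \<open>1\<close> takes care of \<open>A = 0\<close>.\<close>
    define \<eta> where "\<eta> = e / (2 * (A + 1))"
    have \<eta>: "0 < \<eta>" using e A by (simp add: \<eta>_def)
    have "\<eta> * A \<le> \<eta> * (A + 1)" using \<eta> by simp
    also have "\<dots> = e / 2" using A by (auto simp: \<eta>_def field_simps)
    finally have \<eta>A: "\<eta> * A \<le> e / 2" .
    have "(\<lambda>j. (1 + 1/\<eta>) * d j) \<longlonglongrightarrow> (1 + 1/\<eta>) * 0" by (intro tendsto_intros d)
    then have "\<forall>\<^sub>F j in sequentially. (1 + 1/\<eta>) * d j < e / 2"
      using e by (intro order_tendstoD) auto
    then show "\<forall>\<^sub>F j in sequentially. dist (\<integral>x. (X j x)\<^sup>2 \<partial>M) (\<integral>x. (Z x)\<^sup>2 \<partial>M) < e"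
    proof eventually_elim
      case (elim j)
      then show ?case using key[OF \<eta>, of j] \<eta>A unfolding dist_real_def A_def by linarith
    qed
  qed
qed

lemma abs_cos_diff_le: "\<bar>cos x - cos y\<bar> \<le> \<bar>x - y\<bar>" for x y :: real
proof -
  have "\<bar>cos x - cos y\<bar> = 2 * (\<bar>sin ((x + y) / 2)\<bar> * \<bar>sin ((y - x) / 2)\<bar>)"
    by (subst cos_diff_cos) (simp add: abs_mult)
  also have "\<dots> \<le> 2 * (1 * \<bar>(y - x) / 2\<bar>)"
    by (intro mult_left_mono mult_mono abs_sin_x_le_abs_x) auto
  finally show ?thesis by simp
qed

lemma abs_le_add_square:
  fixes x :: real
  assumes \<eta>: "0 < \<eta>"
  shows "\<bar>x\<bar> \<le> \<eta> + 1 / \<eta> * x\<^sup>2"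
proof -
  have "0 \<le> (\<bar>x\<bar> - \<eta>)\<^sup>2 / \<eta> + \<bar>x\<bar>" using \<eta> by simp
  then show ?thesis using \<eta> by (simp add: power2_eq_square field_simps)
qed

lemma (in prob_space) expectation_cos_tendsto:
  assumes [measurable]: "\<And>j. X j \<in> borel_measurable M" "Z \<in> borel_measurable M"
    and conv: "(\<lambda>j. \<integral>\<^sup>+\<omega>. ennreal ((Z \<omega> - X j \<omega>)\<^sup>2) \<partial>M) \<longlonglongrightarrow> 0"
  shows "(\<lambda>j. expectation (\<lambda>\<omega>. cos (X j \<omega> + c))) \<longlonglongrightarrow> expectation (\<lambda>\<omega>. cos (Z \<omega> + c))"
proof (rule tendstoI)
  fix e :: real assume e: "0 < e"
  define \<eta> where "\<eta> = e / 2"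
  have \<eta>: "0 < \<eta>" using e by (simp add: \<eta>_def)
  define bnd where "bnd j = ennreal \<eta> + ennreal (1 / \<eta>) * (\<integral>\<^sup>+\<omega>. ennreal ((Z \<omega> - X j \<omega>)\<^sup>2) \<partial>M)" for j
  have le: "ennreal \<bar>expectation (\<lambda>\<omega>. cos (X j \<omega> + c)) - expectation (\<lambda>\<omega>. cos (Z \<omega> + c))\<bar> \<le> bnd j" for j
  proof -
    have int: "integrable M (\<lambda>\<omega>. cos (V \<omega> + c))" if [measurable]: "V \<in> borel_measurable M" for V
      by (rule integrable_const_bound[where B = 1]) auto
    have pointwise: "\<bar>cos (x + c) - cos (z + c)\<bar> \<le> \<eta> + 1 / \<eta> * (z - x)\<^sup>2" for x z
    proof -
      have "\<bar>cos (x + c) - cos (z + c)\<bar> \<le> \<bar>z - x\<bar>"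
        using abs_cos_diff_le[of "x + c" "z + c"] by simp
      moreover have "\<bar>z - x\<bar> \<le> \<eta> + 1 / \<eta> * (z - x)\<^sup>2"
        by (rule abs_le_add_square[OF \<eta>])
      ultimately show ?thesis by linarith
    qed
    have "ennreal \<bar>expectation (\<lambda>\<omega>. cos (X j \<omega> + c)) - expectation (\<lambda>\<omega>. cos (Z \<omega> + c))\<bar> =
        ennreal (norm (expectation (\<lambda>\<omega>. cos (X j \<omega> + c) - cos (Z \<omega> + c))))"
      using int[of "X j"] int[of Z] by simp
    also have "\<dots> \<le> (\<integral>\<^sup>+\<omega>. norm (cos (X j \<omega> + c) - cos (Z \<omega> + c)) \<partial>M)"
      using int[of "X j"] int[of Z] by (intro integral_norm_bound_ennreal) auto
    also have "\<dots> \<le> (\<integral>\<^sup>+\<omega>. ennreal \<eta> + ennreal (1 / \<eta>) * ennreal ((Z \<omega> - X j \<omega>)\<^sup>2) \<partial>M)"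
      using \<eta> pointwise
      by (intro nn_integral_mono) (simp add: ennreal_mult[symmetric] ennreal_plus[symmetric] del: ennreal_plus)
    also have "\<dots> = bnd j"
      by (simp add: bnd_def nn_integral_add nn_integral_cmult emeasure_space_1)
    finally show ?thesis .
  qed
  have "bnd \<longlonglongrightarrow> ennreal \<eta> + ennreal (1 / \<eta>) * 0"
    unfolding bnd_def by (intro tendsto_add ennreal_tendsto_cmult conv) auto
  then have "\<forall>\<^sub>F j in sequentially. bnd j < ennreal e"
    using e \<eta> by (intro order_tendstoD) (auto simp: \<eta>_def ennreal_less_iff)
  then show "\<forall>\<^sub>F j in sequentially. dist (expectation (\<lambda>\<omega>. cos (X j \<omega> + c))) (expectation (\<lambda>\<omega>. cos (Z \<omega> + c))) < e"
  proof eventually_elim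
    case (elim j)
    from le_less_trans[OF le elim] show ?case by (simp add: dist_real_def ennreal_less_iff)
  qed
qed

text \<open>Since \<open>2 (1 - cos (\<theta> x)) / \<theta>\<^sup>2\<close> tends to \<open>x\<^sup>2\<close> as \<open>\<theta>\<close> tends to \<open>0\<close>, Fatou's lemma bounds the second moment
by the lower limit of \<open>2 (1 - exp (-\<theta>\<^sup>2 v / 2)) / \<theta>\<^sup>2\<close>, and these values do not exceed \<open>v\<close>.\<close>

lemma (in prob_space) second_moment_le:
  assumes [measurable]: "X \<in> borel_measurable M"
    and cos: "\<And>\<theta>. expectation (\<lambda>\<omega>. cos (\<theta> * X \<omega>)) = exp (- (\<theta>\<^sup>2 * v / 2))"
  shows "(\<integral>\<^sup>+\<omega>. ennreal ((X \<omega>)\<^sup>2) \<partial>M) \<le> ennreal v"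
proof -
  \<comment> \<open>The choice \<open>\<theta> = 1 / (n + 1)\<close>.\<close>
  define f where "f n \<omega> = 2 * (real (Suc n))\<^sup>2 * (1 - cos (1 / real (Suc n) * X \<omega>))" for n \<omega>
  have [measurable]: "f n \<in> borel_measurable M" for n unfolding f_def by measurable
  have "(\<lambda>n. 2 * (real (Suc n))\<^sup>2 * (1 - cos (1 / real (Suc n) * x))) \<longlonglongrightarrow> x\<^sup>2" for x
  proof (cases "x = 0")
    case False
    then show ?thesis by (cases "x > 0") (real_asymp simp: power2_eq_square field_simps)+
  qed simp
  then have "(\<lambda>n. ennreal (f n \<omega>)) \<longlonglongrightarrow> ennreal ((X \<omega>)\<^sup>2)" for \<omega>
    unfolding f_def by (intro tendsto_ennrealI)
  from lim_imp_Liminf[OF _ this]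
  have "(\<integral>\<^sup>+\<omega>. ennreal ((X \<omega>)\<^sup>2) \<partial>M) = (\<integral>\<^sup>+\<omega>. liminf (\<lambda>n. ennreal (f n \<omega>)) \<partial>M)"
    by simp
  also have "\<dots> \<le> liminf (\<lambda>n. \<integral>\<^sup>+\<omega>. ennreal (f n \<omega>) \<partial>M)"
    by (rule nn_integral_liminf) measurable
  also have "\<dots> \<le> ennreal v"
  proof (rule Liminf_le, simp, rule always_eventually, rule allI)
    fix n
    have i: "integrable M (\<lambda>\<omega>. cos (1 / real (Suc n) * X \<omega>))"
      by (rule integrable_const_bound[where B = 1]) auto
    have "integrable M (f n)"
      unfolding f_def by (intro integrable_mult_right Bochner_Integration.integrable_diff i integrable_const)
    moreover have "0 \<le> f n \<omega>" for \<omega> by (simp add: f_def)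
    ultimately have "(\<integral>\<^sup>+\<omega>. ennreal (f n \<omega>) \<partial>M) = ennreal (expectation (f n))"
      by (intro nn_integral_eq_integral) auto
    also have "expectation (f n) = 2 * (real (Suc n))\<^sup>2 * (1 - exp (- ((1 / real (Suc n))\<^sup>2 * v / 2)))"
      unfolding f_def using i cos[of "1 / real (Suc n)"] by (simp add: prob_space)
    also have "\<dots> \<le> 2 * (real (Suc n))\<^sup>2 * ((1 / real (Suc n))\<^sup>2 * v / 2)"
    proof (rule mult_left_mono)
      show "1 - exp (- ((1 / real (Suc n))\<^sup>2 * v / 2)) \<le> (1 / real (Suc n))\<^sup>2 * v / 2"
        using exp_ge_add_one_self[of "- ((1 / real (Suc n))\<^sup>2 * v / 2)"] by linarith
    qed simp
    also have "\<dots> = v" by (simp add: power2_eq_square)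
    finally show "(\<integral>\<^sup>+\<omega>. ennreal (f n \<omega>) \<partial>M) \<le> ennreal v" by (simp add: ennreal_leI)
  qed
  finally show ?thesis .
qed

section \<open>Independent Gaussian variables\<close>

lemma (in prob_space) char_gaussian_rv:
  assumes "gaussian_rv M X 0 v"
  shows "char (distr M borel X) t = complex_of_real (exp (- (t\<^sup>2 * v / 2)))"
proof (cases "v = 0")
  case True
  with assms have [measurable]: "X \<in> borel_measurable M" and "AE \<omega> in M. X \<omega> = 0"
    by (auto simp: gaussian_rv_def)
  then have "AE \<omega> in M. iexp (t * X \<omega>) = 1" by (auto elim: eventually_mono)
  then have "(\<integral>\<omega>. iexp (t * X \<omega>) \<partial>M) = (\<integral>\<omega>. 1 \<partial>M)"
    by (intro integral_cong_AE) auto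
  with True show ?thesis by (simp add: char_def integral_distr prob_space)
next
  case False
  with assms have v: "0 < v" and X: "distributed M lborel X (normal_density 0 (sqrt v))"
    and [measurable]: "X \<in> borel_measurable M"
    by (auto simp: gaussian_rv_def)
  define Z where "Z \<omega> = X \<omega> / sqrt v" for \<omega>
  have [measurable]: "Z \<in> borel_measurable M" unfolding Z_def by measurable
  have "distributed M lborel Z std_normal_density"
    using X v normal_standard_normal_convert[of "sqrt v" X 0] by (simp add: Z_def[abs_def])
  then have Z: "distr M borel Z = std_normal_distribution"
    using distributed_distr_eq_density[of M lborel Z] by (simp cong: distr_cong)
  have "char (distr M borel X) t = char (distr M borel Z) (t * sqrt v)"
    using v by (simp add: char_def integral_distr Z_def)
  also have "\<dots> = complex_of_real (exp (- (t\<^sup>2 * v / 2)))"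
    using v by (simp add: Z char_std_normal_distribution power_mult_distrib)
  finally show ?thesis .
qed

lemma (in prob_space) expectation_cos_gaussian_combination:
  assumes "finite A" and ind: "indep_vars (\<lambda>_. borel) X A"
    and gauss: "\<And>i. i \<in> A \<Longrightarrow> gaussian_rv M (X i) 0 (v i)"
  shows "expectation (\<lambda>\<omega>. cos ((\<Sum>i\<in>A. a i * X i \<omega>) + c)) = cos c * exp (- ((\<Sum>i\<in>A. (a i)\<^sup>2 * v i) / 2))"
proof -
  have [measurable]: "X i \<in> borel_measurable M" if "i \<in> A" for i
    using gauss[OF that] by (simp add: gaussian_rv_def)
  define S where "S \<omega> = (\<Sum>i\<in>A. a i * X i \<omega>)" for \<omega>
  have [measurable]: "S \<in> borel_measurable M" unfolding S_def by measurable
  have "indep_vars (\<lambda>_. borel) (\<lambda>i \<omega>. a i * X i \<omega>) A"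
    by (rule indep_vars_compose2[OF ind]) auto
  from char_distr_sum[OF this]
  have "char (distr M borel S) 1 = (\<Prod>i\<in>A. char (distr M borel (\<lambda>\<omega>. a i * X i \<omega>)) 1)"
    by (simp add: S_def[abs_def])
  also have "\<dots> = (\<Prod>i\<in>A. complex_of_real (exp (- ((a i)\<^sup>2 * v i / 2))))"
  proof (rule prod.cong[OF refl])
    fix i assume i: "i \<in> A"
    then have [measurable]: "X i \<in> borel_measurable M" by measurable
    have "char (distr M borel (\<lambda>\<omega>. a i * X i \<omega>)) 1 = char (distr M borel (X i)) (a i)"
      by (simp add: char_def integral_distr)
    also have "\<dots> = complex_of_real (exp (- ((a i)\<^sup>2 * v i / 2)))"
      by (rule char_gaussian_rv[OF gauss[OF i]])
    finally show "char (distr M borel (\<lambda>\<omega>. a i * X i \<omega>)) 1 = complex_of_real (exp (- ((a i)\<^sup>2 * v i / 2)))" .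
  qed
  also have "\<dots> = complex_of_real (exp (- ((\<Sum>i\<in>A. (a i)\<^sup>2 * v i) / 2)))"
    using \<open>finite A\<close> by (simp add: exp_sum[symmetric] sum_negf sum_divide_distrib flip: of_real_prod)
  finally have char: "(\<integral>\<omega>. iexp (S \<omega>) \<partial>M) = complex_of_real (exp (- ((\<Sum>i\<in>A. (a i)\<^sup>2 * v i) / 2)))"
    by (simp add: char_def integral_distr)
  have int: "integrable M (\<lambda>\<omega>. iexp (S \<omega>))"
    by (rule integrable_const_bound[where B = 1]) auto
  have "expectation (\<lambda>\<omega>. cos (S \<omega> + c)) = expectation (\<lambda>\<omega>. Re (iexp c * iexp (S \<omega>)))"
    by (intro Bochner_Integration.integral_cong refl) (simp add: Re_exp Im_exp cos_add algebra_simps)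
  also have "\<dots> = Re (\<integral>\<omega>. iexp c * iexp (S \<omega>) \<partial>M)"
    using int by (intro integral_Re integrable_mult_right)
  also have "(\<integral>\<omega>. iexp c * iexp (S \<omega>) \<partial>M) = iexp c * complex_of_real (exp (- ((\<Sum>i\<in>A. (a i)\<^sup>2 * v i) / 2)))"
    using char by (simp only: integral_mult_right_zero)
  also have "Re \<dots> = cos c * exp (- ((\<Sum>i\<in>A. (a i)\<^sup>2 * v i) / 2))"
    by (simp add: Re_exp)
  finally show ?thesis by (simp add: S_def)
qed

section \<open>Step functions\<close>

definition scale_step :: "real \<Rightarrow> step_fun \<Rightarrow> step_fun" where
  "scale_step x s = map (\<lambda>(c, a, b). (x * c, a, b)) s"

lemma step_eval_append: "step_eval (s @ s') r = step_eval s r + step_eval s' r"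
  by (simp add: step_eval_def)

lemma step_integral_append: "step_integral B (s @ s') \<omega> = step_integral B s \<omega> + step_integral B s' \<omega>"
  by (simp add: step_integral_def)

lemma valid_step_append: "valid_step (s @ s') \<longleftrightarrow> valid_step s \<and> valid_step s'"
  by (simp add: valid_step_def ball_Un)

lemma step_eval_scale: "step_eval (scale_step x s) r = x * step_eval s r"
  by (induction s) (auto simp: scale_step_def step_eval_def algebra_simps)

lemma step_integral_scale: "step_integral B (scale_step x s) \<omega> = x * step_integral B s \<omega>"
  by (induction s) (auto simp: scale_step_def step_integral_def algebra_simps)

lemma valid_step_scale: "valid_step (scale_step x s) \<longleftrightarrow> valid_step s"
  by (auto simp: valid_step_def scale_step_def)

lemma step_eval_measurable [measurable]: "step_eval s \<in> borel_measurable borel"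
proof -
  have "(\<lambda>r. step_eval s r) \<in> borel_measurable borel"
    by (induction s) (auto simp: step_eval_def)
  then show ?thesis by simp
qed

lemma step_eval_bounded: "\<exists>K. \<forall>r. \<bar>step_eval s r\<bar> \<le> K"
proof (induction s)
  case (Cons x s)
  then obtain K where K: "\<bar>step_eval s r\<bar> \<le> K" for r by blast
  obtain c a b where x: "x = (c, a, b)" by (cases x)
  have "\<bar>step_eval (x # s) r\<bar> \<le> \<bar>c\<bar> + K" for r
    using K[of r] by (auto simp: step_eval_def x split: split_indicator)
  then show ?case by blast
qed (auto simp: step_eval_def)

lemma step_eval_0:
  assumes "valid_step s"
  shows "step_eval s 0 = 0"
  using assms by (induction s) (auto simp: step_eval_def valid_step_def)

text \<open>The integral of a step function is rewritten over a partition that contains all of its endpoints, which turns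
overlapping intervals into disjoint cells. On a cell the step function has its value at the right endpoint. The
function \<open>G\<close> is arbitrary: a Brownian path gives the stochastic integral, and \<open>\<lambda>x. of_bool (r \<le> x)\<close> gives
the value of the step function at \<open>r\<close>.\<close>

lemma increments_refine:
  fixes p :: "nat \<Rightarrow> real" and G :: "real \<Rightarrow> real"
  assumes p: "strict_mono_on {..k} p"
    and s: "\<forall>(c, a, b)\<in>set s. a \<in> p ` {..k} \<and> b \<in> p ` {..k} \<and> a \<le> b"
  shows "(\<Sum>(c, a, b)\<leftarrow>s. c * (G b - G a)) =
      (\<Sum>i<k. step_eval s (p (Suc i)) * (G (p (Suc i)) - G (p i)))"
  using s
proof (induction s)
  case (Cons x s)
  obtain c a b where x: "x = (c, a, b)" by (cases x)
  from Cons.prems x obtain i j where ij: "i \<le> k" "a = p i" "j \<le> k" "b = p j" and "a \<le> b" by auto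
  then have "i \<le> j"
    using strict_mono_onD[OF p, of j i] by (metis atMost_iff leD le_less_linear)
  have "G b - G a = (\<Sum>l=i..<j. G (p (Suc l)) - G (p l))"
    using sum_Suc_diff'[OF \<open>i \<le> j\<close>, of "\<lambda>l. G (p l)"] ij by simp
  also have "\<dots> = (\<Sum>l<k. indicator {a<..b} (p (Suc l)) * (G (p (Suc l)) - G (p l)))"
  proof (rule sum.mono_neutral_cong_left)
    have mem: "p (Suc l) \<in> {a<..b} \<longleftrightarrow> l \<in> {i..<j}" if "l < k" for l
      using strict_mono_on_less[OF p, of i "Suc l"] strict_mono_on_less_eq[OF p, of "Suc l" j] ij that by auto
    show "\<forall>l\<in>{..<k} - {i..<j}. indicator {a<..b} (p (Suc l)) * (G (p (Suc l)) - G (p l)) = 0"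
      using mem by (auto simp: indicator_def)
    show "G (p (Suc l)) - G (p l) = indicator {a<..b} (p (Suc l)) * (G (p (Suc l)) - G (p l))" if "l \<in> {i..<j}" for l
      using mem[of l] that ij by (simp add: indicator_def)
  qed (use ij in auto)
  finally have head: "G b - G a = (\<Sum>l<k. indicator {a<..b} (p (Suc l)) * (G (p (Suc l)) - G (p l)))" .
  have tail: "(\<Sum>(c, a, b)\<leftarrow>s. c * (G b - G a)) = (\<Sum>i<k. step_eval s (p (Suc i)) * (G (p (Suc i)) - G (p i)))"
    using Cons by simp
  have "step_eval (x # s) r = c * indicator {a<..b} r + step_eval s r" for r
    by (simp add: step_eval_def x)
  then have "(\<Sum>i<k. step_eval (x # s) (p (Suc i)) * (G (p (Suc i)) - G (p i))) =
      c * (\<Sum>i<k. indicator {a<..b} (p (Suc i)) * (G (p (Suc i)) - G (p i))) +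
      (\<Sum>i<k. step_eval s (p (Suc i)) * (G (p (Suc i)) - G (p i)))"
    by (simp only: distrib_right sum.distrib sum_distrib_left mult.assoc)
  then show ?case by (simp only: head[symmetric] tail[symmetric]) (simp add: x)
qed (simp add: step_eval_def)

lemma obtain_partition:
  fixes A :: "real set"
  assumes "finite A" "A \<subseteq> {0..1}"
  obtains k and p :: "nat \<Rightarrow> real" where "strict_mono_on {..k} p" "A \<subseteq> p ` {..k}" "p ` {..k} \<subseteq> {0..1}"
proof -
  define L where "L = sorted_list_of_set (insert 0 A)"
  define k where "k = length L - 1"
  have set: "set L = insert 0 A" 
    unfolding L_def using assms by (intro set_sorted_list_of_set) auto
  then have "L \<noteq> []" by auto
  then have k: "{..k} = {..<length L}" by (cases L) (auto simp: k_def)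
  have "strict_mono_on {..k} ((!) L)"
    using strict_sorted_list_of_set[of "insert 0 A"] unfolding k L_def[symmetric]
    by (auto simp: strict_mono_on_def sorted_wrt_iff_nth_less)
  moreover have "(!) L ` {..k} = insert 0 A" using set k by (auto simp: set_conv_nth image_iff)
  ultimately show ?thesis using assms by (intro that[of k "(!) L"]) auto
qed

definition unit_norm_sq :: "(real \<Rightarrow> real) \<Rightarrow> real" where
  "unit_norm_sq f = (LINT r:{0..1}|lborel. (f r)\<^sup>2)"

lemma unit_norm_sq_eq: "unit_norm_sq f = (\<integral>r. (indicator {0..1} r * f r)\<^sup>2 \<partial>lborel)"
  unfolding unit_norm_sq_def set_lebesgue_integral_def
  by (intro Bochner_Integration.integral_cong) (auto split: split_indicator)

lemma unit_nn_integral_eq: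
  "(\<integral>\<^sup>+r\<in>{0..1}. ennreal ((f r)\<^sup>2) \<partial>lborel) = (\<integral>\<^sup>+r. ennreal ((indicator {0..1} r * f r)\<^sup>2) \<partial>lborel)"
  by (intro nn_integral_cong) (auto split: split_indicator)

lemma step_eval_square_integrable: "integrable lborel (\<lambda>r. (indicator {0..1} r * step_eval s r)\<^sup>2)"
proof -
  obtain K where K: "\<bar>step_eval s r\<bar> \<le> K" for r using step_eval_bounded by blast
  have K2: "(step_eval s r)\<^sup>2 \<le> K\<^sup>2" for r
    using power_mono[OF K[of r] abs_ge_zero, of 2] by simp
  show ?thesis
  proof (rule Bochner_Integration.integrable_bound)
    show "integrable lborel (\<lambda>r. K\<^sup>2 * indicator {0..1::real} r)" by simp
    show "AE r in lborel. norm ((indicator {0..1} r * step_eval s r)\<^sup>2) \<le> norm (K\<^sup>2 * indicator {0..1} r :: real)"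
      using K2 by (auto split: split_indicator)
  qed measurable
qed

lemma unit_norm_sq_step:
  assumes p: "strict_mono_on {..k} p" "p ` {..k} \<subseteq> {0..1}"
    and s: "\<forall>(c, a, b)\<in>set s. a \<in> p ` {..k} \<and> b \<in> p ` {..k} \<and> a \<le> b"
  shows "unit_norm_sq (step_eval s) = (\<Sum>i<k. (step_eval s (p (Suc i)))\<^sup>2 * (p (Suc i) - p i))"
proof -
  define c where "c i = step_eval s (p (Suc i))" for i
  define cell where "cell i = {p i<..p (Suc i)}" for i
  have le: "p i \<le> p j" if "i \<le> j" "j \<le> k" for i j
    using strict_mono_on_imp_mono_on[OF p(1)] that by (auto simp: mono_on_def)
  have eval: "step_eval s r = (\<Sum>i<k. c i * indicator (cell i) r)" for r
  proof -
    \<comment> \<open>The increment of \<open>G\<close> over \<open>(a, b]\<close> is the indicator of \<open>(a, b]\<close> at \<open>r\<close>.\<close>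
    define G :: "real \<Rightarrow> real" where "G x = of_bool (r \<le> x)" for x
    have G: "G b - G a = indicator {a<..b} r" if "a \<le> b" for a b
      using that by (auto simp: G_def indicator_def)
    have "step_eval s r = (\<Sum>(c, a, b)\<leftarrow>s. c * (G b - G a))"
      unfolding step_eval_def using s by (intro arg_cong[of _ _ sum_list] map_cong refl) (auto simp: G)
    also have "\<dots> = (\<Sum>i<k. c i * (G (p (Suc i)) - G (p i)))"
      unfolding c_def by (rule increments_refine[OF p(1) s])
    also have "\<dots> = (\<Sum>i<k. c i * indicator (cell i) r)"
      unfolding cell_def by (intro sum.cong refl arg_cong2[of _ _ _ _ "(*)"] G le) auto
    finally show ?thesis .
  qed
  have disjoint: "j = i" if "r \<in> cell i" "r \<in> cell j" "i < k" "j < k" for i j r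
  proof (rule ccontr)
    assume "j \<noteq> i"
    then consider "Suc i \<le> j" | "Suc j \<le> i" by linarith
    then show False
      using le[of "Suc i" j] le[of "Suc j" i] that by cases (auto simp: cell_def)
  qed
  have square: "(indicator {0..1} r * step_eval s r)\<^sup>2 = (\<Sum>i<k. (c i)\<^sup>2 * indicator (cell i) r)" for r
  proof (cases "\<exists>i<k. r \<in> cell i")
    case True
    then obtain i where i: "i < k" "r \<in> cell i" by blast
    have "p i \<in> {0..1}" "p (Suc i) \<in> {0..1}" using p(2) i(1) by (simp_all add: image_subset_iff)
    then have unit: "r \<in> {0..1}" using i(2) unfolding cell_def by auto
    have "indicator (cell j) r = (if j = i then 1 else 0 :: real)" if "j < k" for j
      using disjoint[OF i(2) _ i(1) that] i(2) by (cases "j = i") (simp_all add: indicator_def, blast)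
    then have "(\<Sum>j<k. f j * indicator (cell j) r) = (\<Sum>j<k. f j * (if j = i then 1 else 0))" for f :: "nat \<Rightarrow> real"
      by (intro sum.cong) auto
    then have "(\<Sum>j<k. f j * indicator (cell j) r) = f i" for f :: "nat \<Rightarrow> real"
      using i(1) by (simp add: sum.delta if_distrib[of "\<lambda>u. _ * u"] cong: if_cong)
    with unit show ?thesis by (simp add: eval)
  next
    case False
    then show ?thesis by (simp add: eval)
  qed
  have int: "integrable lborel (\<lambda>r. (c i)\<^sup>2 * indicator (cell i) r)" if "i < k" for i
    unfolding cell_def using le[of i "Suc i"] that
    by (intro integrable_mult_right integrable_real_indicator) auto
  have "unit_norm_sq (step_eval s) = (\<Sum>i<k. \<integral>r. (c i)\<^sup>2 * indicator (cell i) r \<partial>lborel)"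
    unfolding unit_norm_sq_eq square using int by (intro Bochner_Integration.integral_sum) auto
  also have "\<dots> = (\<Sum>i<k. (c i)\<^sup>2 * (p (Suc i) - p i))"
    using le by (intro sum.cong refl) (simp add: cell_def)
  finally show ?thesis by (simp add: c_def)
qed

section \<open>Wiener integral\<close>

context brownian_motion
begin

lemma step_integral_measurable:
  assumes "valid_step s"
  shows "step_integral B s \<in> borel_measurable M"
proof -
  have "(\<lambda>\<omega>. step_integral B s \<omega>) \<in> borel_measurable M"
    using assms
  proof (induction s)
    case (Cons x s)
    obtain c a b where x: "x = (c, a, b)" by (cases x)
    have [measurable]: "B a \<in> borel_measurable M" "B b \<in> borel_measurable M" "(\<lambda>\<omega>. step_integral B s \<omega>) \<in> borel_measurable M"
      using Cons by (auto simp: x valid_step_def intro!: measurable_B)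
    have "step_integral B (x # s) \<omega> = c * (B b \<omega> - B a \<omega>) + step_integral B s \<omega>" for \<omega>
      by (simp add: step_integral_def x)
    then show ?case by simp
  qed (simp add: step_integral_def[abs_def])
  then show ?thesis by simp
qed

text \<open>Over a partition that refines the step function, its integral is a linear combination of independent Gaussian
increments, and the variances of its terms add up to the squared norm of the step function.\<close>

lemma expectation_cos_step:
  assumes s: "valid_step s"
  shows "expectation (\<lambda>\<omega>. cos (step_integral B s \<omega> + c)) = cos c * exp (- (unit_norm_sq (step_eval s) / 2))"
proof -
  define A where "A = (\<Union>(c, a, b)\<in>set s. {a, b})"
  have "finite A" "A \<subseteq> {0..1}" using s by (auto simp: A_def valid_step_def)
  then obtain k and p :: "nat \<Rightarrow> real" where p: "strict_mono_on {..k} p" "A \<subseteq> p ` {..k}" "p ` {..k} \<subseteq> {0..1}"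
    using obtain_partition by blast
  have s': "\<forall>(c, a, b)\<in>set s. a \<in> p ` {..k} \<and> b \<in> p ` {..k} \<and> a \<le> b"
    using p(2) s unfolding A_def valid_step_def by fast
  define X where "X i \<omega> = B (p (Suc i)) \<omega> - B (p i) \<omega>" for i \<omega>
  have eq: "step_integral B s \<omega> = (\<Sum>i<k. step_eval s (p (Suc i)) * X i \<omega>)" for \<omega>
    unfolding step_integral_def X_def by (rule increments_refine[OF p(1) s'])
  have "indep_vars (\<lambda>_. borel) X {..<k}"
    using indep_increments[OF p(1,3)] by (simp add: X_def[abs_def])
  moreover have "gaussian_rv M (X i) 0 (p (Suc i) - p i)" if "i \<in> {..<k}" for i
  proof -
    have "p j \<in> {0..1}" if "j \<le> k" for j using p(3) that by blast
    from this[of i] this[of "Suc i"] that have "p i \<in> {0..1}" "p (Suc i) \<in> {0..1}" by auto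
    moreover have "p i < p (Suc i)" using that by (intro strict_mono_onD[OF p(1)]) auto
    ultimately show ?thesis unfolding X_def[abs_def] by (intro gaussian_increments) auto
  qed
  ultimately show ?thesis
    unfolding eq unit_norm_sq_step[OF p(1,3) s']
    by (rule expectation_cos_gaussian_combination[OF finite_lessThan])
qed

lemma second_moment_step_le:
  assumes s: "valid_step s"
  shows "(\<integral>\<^sup>+\<omega>. ennreal ((step_integral B s \<omega>)\<^sup>2) \<partial>M) \<le> ennreal (unit_norm_sq (step_eval s))"
proof (rule second_moment_le[OF step_integral_measurable[OF s]])
  fix \<theta>
  have "unit_norm_sq (step_eval (scale_step \<theta> s)) = \<theta>\<^sup>2 * unit_norm_sq (step_eval s)"
    by (simp add: unit_norm_sq_def step_eval_scale power_mult_distrib)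
  then show "expectation (\<lambda>\<omega>. cos (\<theta> * step_integral B s \<omega>)) = exp (- (\<theta>\<^sup>2 * unit_norm_sq (step_eval s) / 2))"
    using expectation_cos_step[of "scale_step \<theta> s" 0] s
    by (simp add: valid_step_scale step_integral_scale)
qed

lemma has_wiener_integral_lincomb:
  assumes "has_wiener_integral M B f I" "has_wiener_integral M B g J"
  shows "has_wiener_integral M B (\<lambda>r. \<alpha> * f r + \<beta> * g r) (\<lambda>\<omega>. \<alpha> * I \<omega> + \<beta> * J \<omega>)"
proof -
  from assms obtain s s' where s: "\<And>j. valid_step (s j)" "\<And>j. valid_step (s' j)"
    and f: "(\<lambda>j. \<integral>\<^sup>+r\<in>{0..1}. ennreal ((f r - step_eval (s j) r)\<^sup>2) \<partial>lborel) \<longlonglongrightarrow> 0"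
    and g: "(\<lambda>j. \<integral>\<^sup>+r\<in>{0..1}. ennreal ((g r - step_eval (s' j) r)\<^sup>2) \<partial>lborel) \<longlonglongrightarrow> 0"
    and I: "(\<lambda>j. \<integral>\<^sup>+\<omega>. ennreal ((I \<omega> - step_integral B (s j) \<omega>)\<^sup>2) \<partial>M) \<longlonglongrightarrow> 0"
    and J: "(\<lambda>j. \<integral>\<^sup>+\<omega>. ennreal ((J \<omega> - step_integral B (s' j) \<omega>)\<^sup>2) \<partial>M) \<longlonglongrightarrow> 0"
    unfolding has_wiener_integral_def by blast
  from assms have meas_f: "(\<lambda>r. indicator {0..1} r * f r) \<in> borel_measurable lborel"
    "(\<lambda>r. indicator {0..1} r * g r) \<in> borel_measurable lborel"
    by (simp_all add: has_wiener_integral_def set_borel_measurable_def)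
  note [measurable] = meas_f[simplified]
  from assms have [measurable]: "I \<in> borel_measurable M" "J \<in> borel_measurable M"
    by (simp_all add: has_wiener_integral_def)
  note [measurable] = step_integral_measurable[OF s(1)] step_integral_measurable[OF s(2)]
  define t where "t j = scale_step \<alpha> (s j) @ scale_step \<beta> (s' j)" for j
  show ?thesis
    unfolding has_wiener_integral_def
  proof (intro conjI exI[of _ t] allI)
    have "(\<lambda>r. \<alpha> * (indicator {0..1} r * f r) + \<beta> * (indicator {0..1} r * g r)) \<in> borel_measurable lborel"
      by measurable
    then show "set_borel_measurable lborel {0..1} (\<lambda>r. \<alpha> * f r + \<beta> * g r)"
      unfolding set_borel_measurable_def by (simp add: algebra_simps)
    show "(\<lambda>\<omega>. \<alpha> * I \<omega> + \<beta> * J \<omega>) \<in> borel_measurable M" by measurable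
    show "valid_step (t j)" for j using s by (simp add: t_def valid_step_append valid_step_scale)
    have "(\<lambda>j. \<integral>\<^sup>+r. ennreal ((\<alpha> * (indicator {0..1} r * f r - indicator {0..1} r * step_eval (s j) r) +
        \<beta> * (indicator {0..1} r * g r - indicator {0..1} r * step_eval (s' j) r))\<^sup>2) \<partial>lborel) \<longlonglongrightarrow> 0"
      using f g unfolding unit_nn_integral_eq
      by (intro mean_square_lincomb_tendsto_0) (auto simp: right_diff_distrib)
    then show "(\<lambda>j. \<integral>\<^sup>+r\<in>{0..1}. ennreal ((\<alpha> * f r + \<beta> * g r - step_eval (t j) r)\<^sup>2) \<partial>lborel) \<longlonglongrightarrow> 0"
      unfolding unit_nn_integral_eq by (simp add: t_def step_eval_append step_eval_scale algebra_simps)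
    have "(\<lambda>j. \<integral>\<^sup>+\<omega>. ennreal ((\<alpha> * (I \<omega> - step_integral B (s j) \<omega>) + \<beta> * (J \<omega> - step_integral B (s' j) \<omega>))\<^sup>2) \<partial>M) \<longlonglongrightarrow> 0"
      using I J by (intro mean_square_lincomb_tendsto_0) auto
    then show "(\<lambda>j. \<integral>\<^sup>+\<omega>. ennreal ((\<alpha> * I \<omega> + \<beta> * J \<omega> - step_integral B (t j) \<omega>)\<^sup>2) \<partial>M) \<longlonglongrightarrow> 0"
      by (simp add: t_def step_integral_append step_integral_scale algebra_simps)
  qed
qed

lemma has_wiener_integral_step:
  assumes "valid_step s"
  shows "has_wiener_integral M B (step_eval s) (step_integral B s)"
  unfolding has_wiener_integral_def set_borel_measurable_def
  using assms step_integral_measurable[OF assms]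
  by (auto intro!: exI[of _ "\<lambda>_. s"])

lemma has_wiener_integral_sum:
  assumes "finite A" "\<And>n. n \<in> A \<Longrightarrow> has_wiener_integral M B (f n) (I n)"
  shows "has_wiener_integral M B (\<lambda>r. \<Sum>n\<in>A. a n * f n r) (\<lambda>\<omega>. \<Sum>n\<in>A. a n * I n \<omega>)"
  using assms
proof (induction A rule: finite_induct)
  case empty
  have "has_wiener_integral M B (step_eval []) (step_integral B [])"
    by (rule has_wiener_integral_step) (simp add: valid_step_def)
  then show ?case by (simp add: step_eval_def[abs_def] step_integral_def[abs_def])
next
  case (insert n A)
  have "has_wiener_integral M B (\<lambda>r. a n * f n r + 1 * (\<Sum>n\<in>A. a n * f n r)) (\<lambda>\<omega>. a n * I n \<omega> + 1 * (\<Sum>n\<in>A. a n * I n \<omega>))"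
    using insert by (intro has_wiener_integral_lincomb) auto
  with insert show ?case by simp
qed

text \<open>This identity for all \<open>c\<close>, and all multiples of \<open>f\<close>, says that the integral of \<open>f\<close> is centred Gaussian with variance
\<open>\<parallel>f\<parallel>\<^sup>2\<close>. It passes from step functions to the limit because both sides are continuous under the convergence in mean
square that defines the integral.\<close>

lemma expectation_cos_wiener:
  assumes "has_wiener_integral M B f I"
  shows "expectation (\<lambda>\<omega>. cos (I \<omega> + c)) = cos c * exp (- (unit_norm_sq f / 2))"
proof -
  from assms obtain s where s: "\<And>j. valid_step (s j)"
    and f: "(\<lambda>j. \<integral>\<^sup>+r\<in>{0..1}. ennreal ((f r - step_eval (s j) r)\<^sup>2) \<partial>lborel) \<longlonglongrightarrow> 0"
    and I: "(\<lambda>j. \<integral>\<^sup>+\<omega>. ennreal ((I \<omega> - step_integral B (s j) \<omega>)\<^sup>2) \<partial>M) \<longlonglongrightarrow> 0"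
    unfolding has_wiener_integral_def by blast
  from assms have [measurable]: "I \<in> borel_measurable M"
    and mf: "(\<lambda>r. indicator {0..1} r * f r) \<in> borel_measurable lborel"
    by (simp_all add: has_wiener_integral_def set_borel_measurable_def)
  have "(\<lambda>j. unit_norm_sq (step_eval (s j))) \<longlonglongrightarrow> unit_norm_sq f"
    unfolding unit_norm_sq_eq
  proof (rule integral_square_tendsto[OF _ mf step_eval_square_integrable])
    show "(\<lambda>j. \<integral>\<^sup>+r. ennreal ((indicator {0..1} r * f r - indicator {0..1} r * step_eval (s j) r)\<^sup>2) \<partial>lborel) \<longlonglongrightarrow> 0"
      using f unfolding unit_nn_integral_eq by (simp add: right_diff_distrib)
  qed measurable
  then have "(\<lambda>j. cos c * exp (- (unit_norm_sq (step_eval (s j)) / 2))) \<longlonglongrightarrow> cos c * exp (- (unit_norm_sq f / 2))"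
    by (intro tendsto_intros) auto
  moreover have "(\<lambda>j. cos c * exp (- (unit_norm_sq (step_eval (s j)) / 2))) \<longlonglongrightarrow> expectation (\<lambda>\<omega>. cos (I \<omega> + c))"
    using expectation_cos_tendsto[OF step_integral_measurable[OF s] _ I, of c]
    by (simp add: expectation_cos_step[OF s])
  ultimately show ?thesis by (rule LIMSEQ_unique[symmetric])
qed

end

context brownian_motion
begin

text \<open>The approximations of \<open>f\<close> converge at a geometric rate, so by the isometry the increments of their integrals are
summable in mean. Hence the integrals converge almost surely, and Fatou's lemma turns the almost sure limit into a limit in
mean square.\<close>

lemma has_wiener_integral_exists:
  assumes meas: "set_borel_measurable lborel {0..1} f" and s: "\<And>j. valid_step (s j)"
    and L: "0 \<le> L" and bound: "\<And>j r. r \<in> {0<..1} \<Longrightarrow> \<bar>f r - step_eval (s j) r\<bar> \<le> L * (1/2) ^ j"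
  shows "\<exists>I. has_wiener_integral M B f I"
proof -
  define S where "S j = step_integral B (s j)" for j
  have [measurable]: "S j \<in> borel_measurable M" for j
    unfolding S_def by (rule step_integral_measurable[OF s])
  have diff: "(\<integral>\<^sup>+\<omega>. ennreal ((S l \<omega> - S j \<omega>)\<^sup>2) \<partial>M) \<le> ennreal ((2 * L * (1/2) ^ j)\<^sup>2)" if "j \<le> l" for j l
  proof -
    define t where "t = s l @ scale_step (-1) (s j)"
    have t: "valid_step t" using s by (simp add: t_def valid_step_append valid_step_scale)
    have t_eval: "step_eval t r = step_eval (s l) r - step_eval (s j) r" for r
      by (simp add: t_def step_eval_append step_eval_scale)
    have b: "\<bar>step_eval t r\<bar> \<le> 2 * L * (1/2) ^ j" if "r \<in> {0..1}" for r
    proof (cases "r = 0")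
      case True
      with L show ?thesis by (simp add: step_eval_0[OF t])
    next
      case False
      with that have r: "r \<in> {0<..1}" by auto
      have "L * (1/2) ^ l \<le> L * (1/2) ^ j"
        using L \<open>j \<le> l\<close> by (intro mult_left_mono power_decreasing) auto
      with bound[OF r, of l] bound[OF r, of j] show ?thesis unfolding t_eval by linarith
    qed
    have sq: "(indicator {0..1} r * step_eval t r)\<^sup>2 \<le> (2 * L * (1/2) ^ j)\<^sup>2 * indicator {0..1} r" for r
      using power_mono[OF b[of r] abs_ge_zero, of 2] by (cases "r \<in> {0..1}") simp_all
    have "unit_norm_sq (step_eval t) \<le> (\<integral>r. (2 * L * (1/2) ^ j)\<^sup>2 * indicator {0..1::real} r \<partial>lborel)"
      unfolding unit_norm_sq_eq
    proof (rule Bochner_Integration.integral_mono[OF step_eval_square_integrable])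
      show "integrable lborel (\<lambda>r. (2 * L * (1/2) ^ j)\<^sup>2 * indicator {0..1::real} r)" by simp
    qed (rule sq)
    also have "\<dots> = (2 * L * (1/2) ^ j)\<^sup>2" by simp
    finally have "ennreal (unit_norm_sq (step_eval t)) \<le> ennreal ((2 * L * (1/2) ^ j)\<^sup>2)"
      by (rule ennreal_leI)
    from order_trans[OF second_moment_step_le[OF t] this] show ?thesis
      by (simp add: S_def t_def step_integral_append step_integral_scale)
  qed
  have first: "(\<integral>\<^sup>+\<omega>. ennreal \<bar>S (Suc j) \<omega> - S j \<omega>\<bar> \<partial>M) \<le> ennreal ((1 + 4 * L\<^sup>2) * (1/2) ^ j)" for j
  proof -
    \<comment> \<open>With the weight \<open>q = 2\<^sup>-\<^sup>j\<close> both terms of \<open>\<bar>x\<bar> \<le> q + x\<^sup>2 / q\<close> have expectation of order \<open>2\<^sup>-\<^sup>j\<close>.\<close>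
    define q :: real where "q = (1/2) ^ j"
    have q: "0 < q" by (simp add: q_def)
    have "(\<integral>\<^sup>+\<omega>. ennreal \<bar>S (Suc j) \<omega> - S j \<omega>\<bar> \<partial>M) \<le>
        (\<integral>\<^sup>+\<omega>. ennreal q + ennreal (1 / q) * ennreal ((S (Suc j) \<omega> - S j \<omega>)\<^sup>2) \<partial>M)"
      using q abs_le_add_square[OF q]
      by (intro nn_integral_mono) (simp add: ennreal_mult[symmetric] ennreal_plus[symmetric] del: ennreal_plus)
    also have "\<dots> = ennreal q + ennreal (1 / q) * (\<integral>\<^sup>+\<omega>. ennreal ((S (Suc j) \<omega> - S j \<omega>)\<^sup>2) \<partial>M)"
      by (simp add: nn_integral_add nn_integral_cmult emeasure_space_1)
    also have "\<dots> \<le> ennreal q + ennreal (1 / q) * ennreal ((2 * L * q)\<^sup>2)"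
      using diff[of j "Suc j"] unfolding q_def by (intro add_left_mono mult_left_mono) auto
    also have "\<dots> = ennreal ((1 + 4 * L\<^sup>2) * q)"
    proof -
      have "(1 + 4 * L\<^sup>2) * q = q + 1 / q * (2 * L * q)\<^sup>2"
        using q by (simp add: power2_eq_square field_simps)
      then show ?thesis
        using q by (simp only: ennreal_mult[symmetric] ennreal_plus[symmetric] zero_le_power2
            zero_le_divide_1_iff less_imp_le mult_nonneg_nonneg)
    qed
    finally show ?thesis by (simp add: q_def)
  qed
  have "summable (\<lambda>j. (1 + 4 * L\<^sup>2) * (1/2) ^ j :: real)"
    by (intro summable_mult summable_geometric) simp
  then have "(\<Sum>j. ennreal ((1 + 4 * L\<^sup>2) * (1/2) ^ j)) \<noteq> top"
    by (intro ennreal_suminf_neq_top) auto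
  moreover have "(\<Sum>j. \<integral>\<^sup>+\<omega>. ennreal \<bar>S (Suc j) \<omega> - S j \<omega>\<bar> \<partial>M) \<le> (\<Sum>j. ennreal ((1 + 4 * L\<^sup>2) * (1/2) ^ j))"
    by (intro suminf_le first summableI)
  ultimately have "(\<integral>\<^sup>+\<omega>. (\<Sum>j. ennreal \<bar>S (Suc j) \<omega> - S j \<omega>\<bar>) \<partial>M) \<noteq> \<infinity>"
    by (subst nn_integral_suminf) (auto simp: top_unique)
  then have "AE \<omega> in M. (\<Sum>j. ennreal \<bar>S (Suc j) \<omega> - S j \<omega>\<bar>) \<noteq> \<infinity>"
    by (intro nn_integral_noteq_infinite) auto
  then have lim: "AE \<omega> in M. (\<lambda>j. S j \<omega>) \<longlonglongrightarrow> lim (\<lambda>j. S j \<omega>)"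
  proof (rule eventually_mono)
    fix \<omega> assume "(\<Sum>j. ennreal \<bar>S (Suc j) \<omega> - S j \<omega>\<bar>) \<noteq> \<infinity>"
    then have "summable (\<lambda>j. \<bar>S (Suc j) \<omega> - S j \<omega>\<bar>)"
      by (intro summable_suminf_not_top) auto
    from summable_LIMSEQ[OF summable_rabs_cancel[OF this]]
    have "(\<lambda>n. S n \<omega> - S 0 \<omega>) \<longlonglongrightarrow> (\<Sum>j. S (Suc j) \<omega> - S j \<omega>)"
      by (simp add: sum_lessThan_telescope[of "\<lambda>j. S j \<omega>"])
    from tendsto_add[OF this tendsto_const[of "S 0 \<omega>"]]
    have "convergent (\<lambda>n. S n \<omega>)" by (auto simp: convergent_def)
    then show "(\<lambda>j. S j \<omega>) \<longlonglongrightarrow> lim (\<lambda>j. S j \<omega>)" by (simp add: convergent_LIMSEQ_iff)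
  qed
  define I where "I \<omega> = lim (\<lambda>j. S j \<omega>)" for \<omega>
  have [measurable]: "I \<in> borel_measurable M" unfolding I_def by measurable
  have fatou: "(\<integral>\<^sup>+\<omega>. ennreal ((I \<omega> - S j \<omega>)\<^sup>2) \<partial>M) \<le> ennreal ((2 * L * (1/2) ^ j)\<^sup>2)" for j
  proof -
    have "(\<integral>\<^sup>+\<omega>. ennreal ((I \<omega> - S j \<omega>)\<^sup>2) \<partial>M) = (\<integral>\<^sup>+\<omega>. liminf (\<lambda>l. ennreal ((S l \<omega> - S j \<omega>)\<^sup>2)) \<partial>M)"
    proof (rule nn_integral_cong_AE, use lim in eventually_elim)
      case (elim \<omega>)
      then have "(\<lambda>l. ennreal ((S l \<omega> - S j \<omega>)\<^sup>2)) \<longlonglongrightarrow> ennreal ((I \<omega> - S j \<omega>)\<^sup>2)"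
        unfolding I_def by (intro tendsto_ennrealI tendsto_intros)
      from lim_imp_Liminf[OF _ this] show ?case by simp
    qed
    also have "\<dots> \<le> liminf (\<lambda>l. \<integral>\<^sup>+\<omega>. ennreal ((S l \<omega> - S j \<omega>)\<^sup>2) \<partial>M)"
      by (rule nn_integral_liminf) measurable
    also have "\<dots> \<le> ennreal ((2 * L * (1/2) ^ j)\<^sup>2)"
      by (intro Liminf_le eventually_mono[OF eventually_ge_at_top[of j]] diff) auto
    finally show ?thesis .
  qed
  have mf: "(\<lambda>r. indicator {0..1} r * f r) \<in> borel_measurable lborel"
    using meas by (simp add: set_borel_measurable_def)
  have L2: "(\<integral>\<^sup>+r\<in>{0..1}. ennreal ((f r - step_eval (s j) r)\<^sup>2) \<partial>lborel) \<le> ennreal ((2 * L * (1/2) ^ j)\<^sup>2)" for j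
  proof -
    have "(\<integral>\<^sup>+r\<in>{0..1}. ennreal ((f r - step_eval (s j) r)\<^sup>2) \<partial>lborel) \<le>
        (\<integral>\<^sup>+r\<in>{0..1::real}. ennreal ((2 * L * (1/2) ^ j)\<^sup>2) \<partial>lborel)"
    \<comment> \<open>The estimate may fail at \<open>0\<close>, where the approximating step functions vanish.\<close>
    proof (rule nn_integral_mono_AE, use AE_lborel_singleton[of "0::real"] in eventually_elim)
      case (elim r)
      show ?case
      proof (cases "r \<in> {0..1}")
        case True
        with elim have "\<bar>f r - step_eval (s j) r\<bar> \<le> L * (1/2) ^ j" by (intro bound) auto
        also have "\<dots> \<le> 2 * L * (1/2) ^ j" using L by simp
        finally have "\<bar>f r - step_eval (s j) r\<bar>\<^sup>2 \<le> (2 * L * (1/2) ^ j)\<^sup>2" by (intro power_mono) auto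
        with True show ?thesis by (simp add: ennreal_leI)
      qed simp
    qed
    also have "\<dots> = ennreal ((2 * L * (1/2) ^ j)\<^sup>2)" by (simp add: nn_integral_cmult_indicator)
    finally show ?thesis .
  qed
  have "(\<lambda>j. ennreal ((2 * L * (1/2) ^ j)\<^sup>2)) \<longlonglongrightarrow> ennreal ((2 * L * 0)\<^sup>2)"
    by (intro tendsto_ennrealI tendsto_intros) auto
  then have bound_0: "(\<lambda>j. ennreal ((2 * L * (1/2) ^ j)\<^sup>2)) \<longlonglongrightarrow> 0" by simp
  have "has_wiener_integral M B f I"
    unfolding has_wiener_integral_def
  proof (intro conjI exI[of _ s] allI meas s)
    show "(\<lambda>j. \<integral>\<^sup>+r\<in>{0..1}. ennreal ((f r - step_eval (s j) r)\<^sup>2) \<partial>lborel) \<longlonglongrightarrow> 0"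
      by (rule tendsto_sandwich[OF _ _ tendsto_const bound_0]) (auto simp: L2)
    show "(\<lambda>j. \<integral>\<^sup>+\<omega>. ennreal ((I \<omega> - step_integral B (s j) \<omega>)\<^sup>2) \<partial>M) \<longlonglongrightarrow> 0"
      by (rule tendsto_sandwich[OF _ _ tendsto_const bound_0]) (auto simp: fatou[unfolded S_def])
  qed measurable
  then show ?thesis by blast
qed

text \<open>The approximations take the value of \<open>f\<close> at the right endpoint on each of \<open>2\<^sup>j\<close> intervals of equal length.\<close>

lemma has_wiener_integral_lipschitz:
  assumes meas: "f \<in> borel_measurable borel" and L: "0 \<le> L" and lip: "\<And>x y. \<bar>f x - f y\<bar> \<le> L * \<bar>x - y\<bar>"
  shows "has_wiener_integral M B f (wiener_integral M B f)"
proof -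
  define s where "s j = map (\<lambda>i. (f (real (Suc i) / 2 ^ j), real i / 2 ^ j, real (Suc i) / 2 ^ j)) [0..<2 ^ j]" for j :: nat
  have "\<exists>I. has_wiener_integral M B f I"
  proof (rule has_wiener_integral_exists[where s = s, OF _ _ L])
    show "set_borel_measurable lborel {0..1} f"
      using meas by (simp add: set_borel_measurable_def)
    show "valid_step (s j)" for j
    proof -
      have "real (Suc i) / 2 ^ j \<le> 1" if "i < 2 ^ j" for i
      proof -
        have "real (Suc i) \<le> real (2 ^ j)" using that by (intro of_nat_mono) simp
        then show ?thesis by simp
      qed
      then show ?thesis by (auto simp: s_def valid_step_def divide_right_mono)
    qed
    show "\<bar>f r - step_eval (s j) r\<bar> \<le> L * (1/2) ^ j" if r: "r \<in> {0<..1}" for j r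
    proof -
      define n :: nat where "n = 2 ^ j"
      have n: "real n = 2 ^ j" "0 < real n" by (simp_all add: n_def)
      define cell where "cell i = {real i / real n<..real (Suc i) / real n}" for i
      \<comment> \<open>The indicators of the cells are increments of \<open>G\<close>, so they add up to \<open>1\<close> on \<open>(0, 1]\<close>.\<close>
      define G :: "nat \<Rightarrow> real" where "G i = of_bool (r \<le> real i / real n)" for i
      have "indicator (cell i) r = G (Suc i) - G i" for i
        using divide_right_mono[of "real i" "real (Suc i)" "real n"]
        by (auto simp: G_def cell_def indicator_def)
      then have "(\<Sum>i<n. indicator (cell i) r) = G n - G 0"
        by (simp only: sum_lessThan_telescope)
      then have one: "(\<Sum>i<n. indicator (cell i) r) = (1::real)"
        using r n(2) by (simp add: G_def)
      have "step_eval (s j) r = (\<Sum>i<n. f (real (Suc i) / real n) * indicator (cell i) r)"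
        unfolding step_eval_def s_def n_def[symmetric] cell_def n(1)
        by (simp add: comp_def interv_sum_list_conv_sum_set_nat atLeast0LessThan)
      moreover have "f r = (\<Sum>i<n. f r * indicator (cell i) r)"
        unfolding sum_distrib_left[symmetric] one by simp
      ultimately have "f r - step_eval (s j) r = (\<Sum>i<n. (f r - f (real (Suc i) / real n)) * indicator (cell i) r)"
        by (simp only: left_diff_distrib sum_subtractf)
      also have "\<bar>\<dots>\<bar> \<le> (\<Sum>i<n. L * (1 / real n) * indicator (cell i) r)"
      proof (rule sum_abs[THEN order_trans], rule sum_mono)
        fix i assume "i \<in> {..<n}"
        show "\<bar>(f r - f (real (Suc i) / real n)) * indicator (cell i) r\<bar> \<le> L * (1 / real n) * indicator (cell i) r"
        proof (cases "r \<in> cell i")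
          case True
          then have "\<bar>r - real (Suc i) / real n\<bar> \<le> 1 / real n"
            by (auto simp: cell_def abs_le_iff add_divide_distrib)
          then have "L * \<bar>r - real (Suc i) / real n\<bar> \<le> L * (1 / real n)" using L by (rule mult_left_mono)
          with lip[of r "real (Suc i) / real n"] True show ?thesis by simp
        qed simp
      qed
      also have "\<dots> = L * (1 / real n)" unfolding sum_distrib_left[symmetric] one by simp
      finally show ?thesis by (simp add: n power_one_over)
    qed
  qed
  then show ?thesis unfolding wiener_integral_def by (rule someI_ex)
qed

lemma has_wiener_integral_cos:
  "has_wiener_integral M B (\<lambda>r. cos (a * r)) (wiener_integral M B (\<lambda>r. cos (a * r)))"
proof (rule has_wiener_integral_lipschitz)
  show "\<bar>cos (a * x) - cos (a * y)\<bar> \<le> \<bar>a\<bar> * \<bar>x - y\<bar>" for x y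
    using abs_cos_diff_le[of "a * x" "a * y"] by (simp add: right_diff_distrib[symmetric] abs_mult)
qed auto

end

section \<open>Tail of the cosine series\<close>

text \<open>The frequencies \<open>\<lambda>\<^sub>n\<close> for which \<open>sin (\<lambda>\<^sub>n t)\<close> are the eigenfunctions of the covariance \<open>min s t\<close> of Brownian motion
on the unit interval.\<close>

definition freq :: "nat \<Rightarrow> real" where "freq n = (real n + 1/2) * pi"

lemma freq_pos: "freq n > 0"
  by (simp add: freq_def)

text \<open>The error of the partial sum of the series of \<open>cos (\<lambda>\<^sub>n x) / \<lambda>\<^sub>n\<^sup>2\<close> as an approximation of its value
\<open>(1 - x) / 2\<close> on \<open>[0, 2]\<close>.\<close>

definition defect :: "nat \<Rightarrow> real \<Rightarrow> real" where
  "defect N x = (1 - x) / 2 - (\<Sum>n\<le>N. cos (freq n * x) / (freq n)\<^sup>2)"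

definition defect_deriv :: "nat \<Rightarrow> real \<Rightarrow> real" where
  "defect_deriv N x = (\<Sum>n\<le>N. sin (freq n * x) / freq n) - 1 / 2"

lemma cos_freq_telescopes:
  "2 * sin (pi * x / 2) * cos (freq n * x) = sin (real (Suc n) * pi * x) - sin (real n * pi * x)"
  by (subst sin_diff_sin) (simp add: freq_def field_simps)

lemma dirichlet_kernel:
  "2 * sin (pi * x / 2) * (\<Sum>n\<le>N. cos (freq n * x)) = sin (real (Suc N) * pi * x)"
proof (induction N)
  case 0 show ?case using cos_freq_telescopes[of x 0] by simp
next
  case (Suc N) show ?case
    using Suc cos_freq_telescopes[of x "Suc N"] by (simp add: distrib_left)
qed

lemma defect_has_derivative: "(defect N has_real_derivative defect_deriv N x) (at x within A)"
  unfolding defect_def defect_deriv_def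
  using freq_pos
  by (auto intro!: derivative_eq_intros sum.cong simp: power2_eq_square less_imp_neq[symmetric] sum_negf[symmetric])

lemma defect_deriv_has_derivative:
  "(defect_deriv N has_real_derivative (\<Sum>n\<le>N. cos (freq n * x))) (at x within A)"
  unfolding defect_deriv_def
  using freq_pos
  by (auto intro!: derivative_eq_intros sum.cong simp: less_imp_neq[symmetric])

lemma sin_freq: "sin (freq n) = (-1) ^ n"
  using sin_add[of "real n * pi" "pi/2"] by (simp add: freq_def distrib_right)

lemma cos_freq: "cos (freq n) = 0"
  using cos_add[of "real n * pi" "pi/2"] by (simp add: freq_def distrib_right)

text \<open>At \<open>x = 1\<close> the sines are alternately \<open>1\<close> and \<open>-1\<close>, and the series is Leibniz's series for \<open>\<pi> / 4\<close>.\<close>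

lemma defect_deriv_1_tendsto: "(\<lambda>N. defect_deriv N 1) \<longlonglongrightarrow> 0"
proof -
  have "(\<lambda>n. (-1) ^ n * 1 / real (n*2+1)) sums (pi / 4)"
    using pi_series summable_arctan_series[of 1] by (simp add: sums_iff)
  from sums_mult[OF this, of "2/pi"] have "(\<lambda>n. sin (freq n * 1) / freq n) sums (1/2)"
    by (simp add: sin_freq) (simp add: freq_def field_simps)
  then have "(\<lambda>N. \<Sum>n\<le>N. sin (freq n * 1) / freq n) \<longlonglongrightarrow> 1/2"
    by (simp add: sums_def_le)
  from tendsto_diff[OF this tendsto_const[of "1/2"]] show ?thesis
    by (simp add: defect_deriv_def)
qed

text \<open>The second derivative of \<open>defect N\<close> is the Dirichlet kernel \<open>sin (\<mu> u) h u\<close> with \<open>\<mu> = (N + 1) \<pi>\<close> and a function \<open>h\<close> that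
is smooth away from \<open>0\<close>. Integration by parts, here in the form that \<open>\<Phi> u = defect_deriv N u + cos (\<mu> u) h u / \<mu>\<close> has
a derivative of order \<open>1 / \<mu>\<close>, shows that the first derivative differs from its value at \<open>1\<close> by \<open>O(1 / N)\<close>, uniformly on
\<open>[x, 1]\<close>. Since \<open>defect N 1 = 0\<close>, the mean value theorem gives the claim.\<close>

lemma defect_tendsto_0_left_half:
  assumes x: "0 < x" "x \<le> 1"
  shows "(\<lambda>N. defect N x) \<longlonglongrightarrow> 0"
proof -
  define s where "s = sin (pi * x / 2)"
  have angle: "0 < pi * u / 2 \<and> pi * u / 2 \<le> pi / 2" if "u \<in> {x..1}" for u
    using that x mult_left_mono[of u 1 pi] by auto
  have s: "0 < s"
    using angle[of x] x pi_gt_zero unfolding s_def by (intro sin_gt_zero) auto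
  have sin_ge: "s \<le> sin (pi * u / 2)" if u: "u \<in> {x..1}" for u
  proof -
    have "pi * x / 2 \<le> pi * u / 2" "- (pi / 2) \<le> pi * x / 2"
      using u x by (auto intro: order_trans[of _ 0])
    then show ?thesis
      using angle[OF u] unfolding s_def by (intro sin_monotone_2pi_le) simp_all
  qed
  define h where "h u = 1 / (2 * sin (pi * u / 2))" for u
  define h' where "h' u = - (pi * cos (pi * u / 2)) / (4 * (sin (pi * u / 2))\<^sup>2)" for u
  have h_bound: "\<bar>h u\<bar> \<le> 1 / (2 * s)" if "u \<in> {x..1}" for u
    using sin_ge[OF that] s by (simp add: h_def frac_le)
  have h'_bound: "\<bar>h' u\<bar> \<le> pi / (4 * s\<^sup>2)" if "u \<in> {x..1}" for u
  proof -
    have "pi * \<bar>cos (pi * u / 2)\<bar> / (4 * (sin (pi * u / 2))\<^sup>2) \<le> pi / (4 * s\<^sup>2)"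
    proof (rule frac_le)
      show "pi * \<bar>cos (pi * u / 2)\<bar> \<le> pi" by (simp add: mult_left_le)
      show "4 * s\<^sup>2 \<le> 4 * (sin (pi * u / 2))\<^sup>2" using sin_ge[OF that] s by simp
    qed (use s in auto)
    then show ?thesis by (simp add: h'_def abs_mult)
  qed
  have h_deriv: "(h has_real_derivative h' u) (at u within A)" if "u \<in> {x..1}" for u A
    unfolding h_def h'_def using sin_ge[OF that] s
    by (auto intro!: derivative_eq_intros simp: power2_eq_square)
  define K where "K = 1 / s + pi / (4 * s\<^sup>2)"
  have K: "0 \<le> K" using s by (simp add: K_def)
  have bound: "\<bar>defect N x\<bar> \<le> \<bar>defect_deriv N 1\<bar> + K / (real (Suc N) * pi)" for N
  proof -
    define \<mu> where "\<mu> = real (Suc N) * pi"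
    have \<mu>: "0 < \<mu>" by (simp add: \<mu>_def)
    \<comment> \<open>The correction \<open>cos (\<mu> u) h u / \<mu>\<close> cancels the Dirichlet kernel up to a term with \<open>h'\<close>.\<close>
    define \<Phi> where "\<Phi> u = defect_deriv N u + cos (\<mu> * u) * h u / \<mu>" for u
    have "(\<Phi> has_real_derivative cos (\<mu> * u) * h' u / \<mu>) (at u within {x..1})" if u: "u \<in> {x..1}" for u
    proof -
      have "(\<Sum>n\<le>N. cos (freq n * u)) = sin (\<mu> * u) * h u"
        using dirichlet_kernel[of u N] sin_ge[OF u] s by (simp add: h_def \<mu>_def field_simps)
      then show ?thesis
        unfolding \<Phi>_def using \<mu>
        by (auto intro!: derivative_eq_intros defect_deriv_has_derivative h_deriv[OF u] simp: field_simps)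
    qed
    moreover have "norm (cos (\<mu> * u) * h' u / \<mu>) \<le> pi / (4 * s\<^sup>2) / \<mu>" if u: "u \<in> {x..1}" for u
    proof -
      have "\<bar>cos (\<mu> * u) * h' u\<bar> \<le> pi / (4 * s\<^sup>2)"
        using mult_mono[OF abs_cos_le_one[of "\<mu> * u"] h'_bound[OF u]] by (simp add: abs_mult)
      from divide_right_mono[OF this, of \<mu>] \<mu> show ?thesis by simp
    qed
    ultimately have \<Phi>: "norm (\<Phi> u - \<Phi> 1) \<le> pi / (4 * s\<^sup>2) / \<mu> * norm (u - 1)" if "u \<in> {x..1}" for u
      using that x by (intro field_differentiable_bound[of "{x..1}"]) auto
    have "norm (defect_deriv N u) \<le> \<bar>defect_deriv N 1\<bar> + K / \<mu>" if u: "u \<in> {x..1}" for u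
    proof -
      have c: "\<bar>cos (\<mu> * v) * h v / \<mu>\<bar> \<le> 1 / (2 * s) / \<mu>" if "v \<in> {x..1}" for v
      proof -
        have "\<bar>cos (\<mu> * v) * h v\<bar> \<le> 1 / (2 * s)"
          using mult_mono[OF abs_cos_le_one[of "\<mu> * v"] h_bound[OF that]] by (simp add: abs_mult)
        from divide_right_mono[OF this, of \<mu>] \<mu> show ?thesis by simp
      qed
      have abs_le: "\<bar>p\<bar> \<le> \<bar>q\<bar> + (2 * e + d)"
        if "\<bar>p + v - (q + w)\<bar> \<le> d'" "d' \<le> d" "\<bar>v\<bar> \<le> e" "\<bar>w\<bar> \<le> e" for p q v w d d' e :: real
        using that by linarith
      have "pi / (4 * s\<^sup>2) / \<mu> * norm (u - 1) \<le> pi / (4 * s\<^sup>2) / \<mu>"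
        using u x \<mu> s by (intro mult_left_le) auto
      from abs_le[OF \<Phi>[OF u, unfolded \<Phi>_def real_norm_def[of "_ - (_ + _)"]] this c[OF u] c[of 1]]
      have "\<bar>defect_deriv N u\<bar> \<le> \<bar>defect_deriv N 1\<bar> + (2 * (1 / (2 * s) / \<mu>) + pi / (4 * s\<^sup>2) / \<mu>)"
        using x by simp
      also have "2 * (1 / (2 * s) / \<mu>) + pi / (4 * s\<^sup>2) / \<mu> = K / \<mu>"
        by (simp add: K_def add_divide_distrib)
      finally show ?thesis by simp
    qed
    then have "norm (defect N x - defect N 1) \<le> (\<bar>defect_deriv N 1\<bar> + K / \<mu>) * norm (x - 1)"
      using x by (intro field_differentiable_bound[of "{x..1}" "defect N" "defect_deriv N"]) (auto intro: defect_has_derivative)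
    also have "\<dots> \<le> (\<bar>defect_deriv N 1\<bar> + K / \<mu>) * 1"
      using x K \<mu> by (intro mult_left_mono) auto
    finally show ?thesis
      by (simp add: \<mu>_def defect_def cos_freq)
  qed
  have "(\<lambda>N. K / (real (Suc N) * pi)) \<longlonglongrightarrow> 0"
    by real_asymp
  from tendsto_add[OF tendsto_rabs[OF defect_deriv_1_tendsto] this]
  have "(\<lambda>N. \<bar>defect_deriv N 1\<bar> + K / (real (Suc N) * pi)) \<longlonglongrightarrow> 0"
    by simp
  then show ?thesis
    by (rule Lim_null_comparison[rotated]) (simp only: real_norm_def bound eventually_True)
qed

lemma summable_inverse_freq_sq: "summable (\<lambda>n. 1 / (freq n)\<^sup>2)"
proof (rule summable_comparison_test)
  show "summable (\<lambda>n. 1 / (real (Suc n))\<^sup>2 * 4)"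
    using inverse_squares_sums by (intro summable_mult2) (simp add: sums_iff)
  have "norm (1 / (freq n)\<^sup>2) \<le> 1 / (real (Suc n))\<^sup>2 * 4" for n
  proof -
    have "(real n + 1) / 2 \<le> (real n + 1/2) * 1" by simp
    also have "\<dots> \<le> freq n" unfolding freq_def using pi_gt3 by (intro mult_left_mono) auto
    finally have "((real n + 1) / 2)\<^sup>2 \<le> (freq n)\<^sup>2" by (intro power_mono) auto
    then have "1 / (freq n)\<^sup>2 \<le> 1 / ((real n + 1) / 2)\<^sup>2" by (intro frac_le) auto
    then show ?thesis by (simp add: power_divide field_simps)
  qed
  then show "\<exists>N. \<forall>n\<ge>N. norm (1 / (freq n)\<^sup>2) \<le> 1 / (real (Suc n))\<^sup>2 * 4" by blast
qed

lemma continuous_cosine_series: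
  "continuous_on UNIV (\<lambda>x. \<Sum>n. cos (freq n * x) / (freq n)\<^sup>2)"
proof (rule uniform_limit_theorem)
  show "uniform_limit UNIV (\<lambda>N x. \<Sum>n<N. cos (freq n * x) / (freq n)\<^sup>2)
      (\<lambda>x. \<Sum>n. cos (freq n * x) / (freq n)\<^sup>2) sequentially"
    by (rule Weierstrass_m_test[OF _ summable_inverse_freq_sq]) (simp add: divide_right_mono)
  show "\<forall>\<^sub>F N in sequentially. continuous_on UNIV (\<lambda>x. \<Sum>n<N. cos (freq n * x) / (freq n)\<^sup>2)"
    using freq_pos by (intro always_eventually allI continuous_intros) (simp add: less_imp_neq[symmetric])
qed simp

lemma cos_freq_reflect: "cos (freq n * (2 - x)) = - cos (freq n * x)"
proof -
  have "freq n * (2 - x) = real (2*n+1) * pi - freq n * x"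
    by (simp add: freq_def distrib_right right_diff_distrib)
  then show ?thesis by (simp only: cos_diff cos_npi sin_npi) simp
qed

lemma defect_reflect: "defect N (2 - x) = - defect N x"
  by (simp only: defect_def cos_freq_reflect minus_divide_left[symmetric] sum_negf) (simp add: field_simps)

text \<open>The point \<open>0\<close> is reached by continuity of the series, and \<open>[1, 2]\<close> by the symmetry
\<open>cos (\<lambda>\<^sub>n (2 - x)) = - cos (\<lambda>\<^sub>n x)\<close>.\<close>

lemma defect_tendsto_0:
  assumes "0 \<le> x" "x \<le> 2"
  shows "(\<lambda>N. defect N x) \<longlonglongrightarrow> 0"
proof -
  have *: "(\<lambda>N. defect N x) \<longlonglongrightarrow> 0" if x: "0 \<le> x" "x \<le> 1" for x
  proof (cases "x = 0")
    case False
    with x show ?thesis by (intro defect_tendsto_0_left_half) auto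
  next
    case True
    define f where "f x = (\<Sum>n. cos (freq n * x) / (freq n)\<^sup>2)" for x
    have "(\<lambda>n. cos (freq n * x) / (freq n)\<^sup>2) sums f x" for x
      unfolding f_def
      by (intro summable_sums summable_comparison_test'[OF summable_inverse_freq_sq])
         (simp add: divide_right_mono)
    then have lim: "(\<lambda>N. defect N x) \<longlonglongrightarrow> (1 - x) / 2 - f x" for x
      unfolding defect_def by (intro tendsto_intros) (simp add: sums_def_le)
    have eq: "f x = (1 - x) / 2" if "0 < x" "x \<le> 1" for x
      using LIMSEQ_unique[OF lim defect_tendsto_0_left_half[OF that]] by simp
    have "(f \<longlongrightarrow> f 0) (at_right 0)"
      using continuous_cosine_series unfolding f_def[symmetric]
      by (auto simp: continuous_on_def intro: tendsto_within_subset)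
    moreover have "((\<lambda>x. (1 - x) / 2) \<longlongrightarrow> (1 - 0) / (2::real)) (at_right 0)"
      by (intro tendsto_intros) auto
    then have "(f \<longlongrightarrow> (1 - 0) / 2) (at_right 0)"
    proof (rule Lim_transform_eventually)
      show "eventually (\<lambda>x. (1 - x) / 2 = f x) (at_right 0)"
        using eventually_at_right_real[of 0 "1::real"] by (rule eventually_mono) (simp_all add: eq)
    qed
    ultimately have "f 0 = (1 - 0) / 2"
      by (intro tendsto_unique) auto
    with lim[of 0] True show ?thesis by simp
  qed
  show ?thesis
  proof (cases "x \<le> 1")
    case False
    with assms have "(\<lambda>N. defect N (2 - x)) \<longlonglongrightarrow> 0" by (intro *) auto
    from tendsto_minus[OF this] show ?thesis by (simp add: defect_reflect)
  qed (use * assms in auto)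
qed

lemma defect_Suc: "defect N x - defect (Suc N) x = cos (freq (Suc N) * x) / (freq (Suc N))\<^sup>2"
  by (simp add: defect_def)

text \<open>Here the defect is the tail of the series of \<open>1 / \<lambda>\<^sub>n\<^sup>2\<close>, whose terms lie between the terms of the telescoping series
for \<open>1 / (\<pi>\<^sup>2 (N + 3/2))\<close> and \<open>1 / (\<pi>\<^sup>2 (N + 1))\<close>. Instead of summing, the differences to the two bounds are
seen to be monotone with limit \<open>0\<close>.\<close>

lemma scaled_defect_0: "(\<lambda>N. real N * defect N 0) \<longlonglongrightarrow> 1 / pi\<^sup>2"
proof -
  define L where "L N = 1 / (pi\<^sup>2 * (real N + 3/2))" for N
  define U where "U N = 1 / (pi\<^sup>2 * (real N + 1))" for N
  note step = defect_Suc[of _ 0, simplified]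
  have dec: "decseq (\<lambda>N. defect N 0 - L N)"
  proof (rule decseq_SucI)
    fix N
    have "L N - L (Suc N) = 1 / (pi\<^sup>2 * ((real N + 3/2) * (real N + 5/2)))"
      by (simp add: L_def divide_simps; simp add: algebra_simps)
    also have "\<dots> \<le> 1 / (pi\<^sup>2 * ((real N + 3/2) * (real N + 3/2)))"
      by (intro frac_le mult_left_mono) auto
    also have "\<dots> = 1 / (freq (Suc N))\<^sup>2"
      by (simp add: freq_def power2_eq_square algebra_simps)
    finally show "defect (Suc N) 0 - L (Suc N) \<le> defect N 0 - L N" using step[of N] by linarith
  qed
  have inc: "incseq (\<lambda>N. defect N 0 - U N)"
  proof (rule incseq_SucI)
    fix N
    have "1 / (freq (Suc N))\<^sup>2 = 1 / (pi\<^sup>2 * ((real N + 3/2) * (real N + 3/2)))"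
      by (simp add: freq_def power2_eq_square algebra_simps)
    also have "\<dots> \<le> 1 / (pi\<^sup>2 * ((real N + 1) * (real N + 2)))"
    proof (intro frac_le mult_left_mono)
      show "(real N + 1) * (real N + 2) \<le> (real N + 3/2) * (real N + 3/2)"
        by (simp add: algebra_simps)
    qed auto
    also have "\<dots> = U N - U (Suc N)"
      by (simp add: U_def divide_simps; simp add: algebra_simps)
    finally show "defect N 0 - U N \<le> defect (Suc N) 0 - U (Suc N)" using step[of N] by linarith
  qed
  have "L \<longlonglongrightarrow> 0" unfolding L_def by real_asymp
  moreover have "U \<longlonglongrightarrow> 0" unfolding U_def by real_asymp
  ultimately have "(\<lambda>N. defect N 0 - L N) \<longlonglongrightarrow> 0 - 0" "(\<lambda>N. defect N 0 - U N) \<longlonglongrightarrow> 0 - 0"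
    by (intro tendsto_diff defect_tendsto_0; simp)+
  then have "L N \<le> defect N 0" "defect N 0 \<le> U N" for N
    using decseq_ge[OF dec, of 0 N] incseq_le[OF inc, of 0 N] by auto
  then have "real N * L N \<le> real N * defect N 0" "real N * defect N 0 \<le> real N * U N" for N
    by (auto intro: mult_left_mono)
  moreover have "(\<lambda>N. 1 / pi\<^sup>2 * (real N / (real N + 3/2))) \<longlonglongrightarrow> 1 / pi\<^sup>2 * 1"
      "(\<lambda>N. 1 / pi\<^sup>2 * (real N / (real N + 1))) \<longlonglongrightarrow> 1 / pi\<^sup>2 * 1"
    by (rule tendsto_mult_left, real_asymp)+
  then have "(\<lambda>N. real N * L N) \<longlonglongrightarrow> 1 / pi\<^sup>2" "(\<lambda>N. real N * U N) \<longlonglongrightarrow> 1 / pi\<^sup>2"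
    by (simp_all add: L_def U_def)
  ultimately show ?thesis
    using tendsto_sandwich[of "\<lambda>N. real N * L N" "\<lambda>N. real N * defect N 0" sequentially "\<lambda>N. real N * U N"]
    by simp
qed

text \<open>Summation by parts: the partial sums of the increments of \<open>b\<close> stay bounded, so only the first
weight counts.\<close>

lemma abel_summation_bound:
  fixes a b :: "nat \<Rightarrow> real"
  assumes dec: "decseq a" and nonneg: "\<And>n. 0 \<le> a n" and b: "\<And>n. \<bar>b n\<bar> \<le> 1"
  shows "\<bar>\<Sum>n=m..<m+l. a n * (b (Suc n) - b n)\<bar> \<le> 2 * a m"
proof -
  \<comment> \<open>The boundary term is split off, for then the induction step adds just \<open>(a (m + l) - a (m + l + 1)) b (m + l + 1)\<close>.\<close>
  have "\<bar>(\<Sum>n=m..<m+l. a n * (b (Suc n) - b n)) - a (m + l) * b (m + l)\<bar> \<le> 2 * a m - a (m + l)"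
  proof (induction l)
    case 0
    show ?case using mult_left_mono[OF b[of m] nonneg[of m]] nonneg[of m] by (simp add: abs_mult)
  next
    case (Suc l)
    have "(a (m + l) - a (m + Suc l)) * \<bar>b (m + Suc l)\<bar> \<le> (a (m + l) - a (m + Suc l)) * 1"
      using decseqD[OF dec, of "m+l" "m + Suc l"] by (intro mult_left_mono b) auto
    moreover have "\<bar>(a (m + l) - a (m + Suc l)) * b (m + Suc l)\<bar> = (a (m + l) - a (m + Suc l)) * \<bar>b (m + Suc l)\<bar>"
      using decseqD[OF dec, of "m+l" "m + Suc l"] by (simp add: abs_mult)
    ultimately have "\<bar>(a (m + l) - a (m + Suc l)) * b (m + Suc l)\<bar> \<le> a (m + l) - a (m + Suc l)"
      by simp
    moreover have "(\<Sum>n=m..<m+Suc l. a n * (b (Suc n) - b n)) - a (m + Suc l) * b (m + Suc l)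
        = ((\<Sum>n=m..<m+l. a n * (b (Suc n) - b n)) - a (m + l) * b (m + l))
          + (a (m + l) - a (m + Suc l)) * b (m + Suc l)"
      by (simp add: algebra_simps)
    ultimately show ?case using Suc by linarith
  qed
  moreover have "\<bar>a (m + l) * b (m + l)\<bar> \<le> a (m + l)"
    using mult_left_mono[OF b[of "m+l"] nonneg[of "m+l"]] nonneg[of "m+l"] by (simp add: abs_mult)
  ultimately show ?thesis by linarith
qed

text \<open>Multiplied by \<open>2 sin (\<pi> x / 2) > 0\<close>, the cosines become increments of \<open>sin (n \<pi> x)\<close>, and summation by parts bounds the
tail by a multiple of its first coefficient, which is of order \<open>1 / N\<^sup>2\<close>.\<close>

lemma scaled_defect_interior:
  assumes x: "0 < x" "x < 2"
  shows "(\<lambda>N. real N * defect N x) \<longlonglongrightarrow> 0"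
proof -
  define s where "s = sin (pi * x / 2)"
  have s: "0 < s" unfolding s_def using x by (intro sin_gt_zero) auto
  define a where "a n = 1 / (freq n)\<^sup>2" for n
  have dec: "decseq a"
    unfolding a_def decseq_def
    by (intro allI impI frac_le power_mono) (auto simp: freq_pos freq_def)
  have fin: "\<bar>2 * s * (defect N x - defect (N + l) x)\<bar> \<le> 2 * a (Suc N)" for N l
  proof -
    have "defect N x - defect (N + l) x = (\<Sum>n=Suc N..<Suc N + l. cos (freq n * x) * a n)"
    proof (induction l)
      case (Suc l)
      then show ?case using defect_Suc[of "N + l" x] by (simp add: a_def)
    qed simp
    then have "2 * s * (defect N x - defect (N + l) x) =
        (\<Sum>n=Suc N..<Suc N + l. a n * (sin (real (Suc n) * pi * x) - sin (real n * pi * x)))"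
      unfolding cos_freq_telescopes[symmetric] s_def
      by (simp only: sum_distrib_left) (simp only: mult_ac)
    also have "\<bar>\<dots>\<bar> \<le> 2 * a (Suc N)"
      by (intro abel_summation_bound[OF dec, of "\<lambda>n. sin (real n * pi * x)"]) (auto simp: a_def)
    finally show ?thesis .
  qed
  have "(\<lambda>l. \<bar>2 * s * (defect N x - defect (l + N) x)\<bar>) \<longlonglongrightarrow> \<bar>2 * s * (defect N x - 0)\<bar>" for N
    using x by (intro tendsto_intros LIMSEQ_ignore_initial_segment defect_tendsto_0) auto
  then have "\<bar>2 * s * (defect N x - 0)\<bar> \<le> 2 * a (Suc N)" for N
  proof (rule LIMSEQ_le_const2, intro exI allI impI)
    show "\<bar>2 * s * (defect N x - defect (l + N) x)\<bar> \<le> 2 * a (Suc N)" for l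
      using fin[of N l] by (simp only: add.commute)
  qed
  then have *: "\<bar>defect N x\<bar> \<le> a (Suc N) / s" for N
    using s by (simp add: abs_mult field_simps)
  have bound: "\<bar>real N * defect N x\<bar> \<le> real N * (a (Suc N) / s)" for N
    using mult_left_mono[OF *[of N], of "real N"] by (simp add: abs_mult)
  have "(\<lambda>N. real N * (a (Suc N) / s)) \<longlonglongrightarrow> 0"
    unfolding a_def freq_def using s by real_asymp
  then show ?thesis
    by (rule Lim_null_comparison[rotated]) (simp only: real_norm_def bound eventually_True)
qed

definition limit_variance :: "real \<Rightarrow> real" where
  "limit_variance t = (if t = 0 then 0 else if t = 1 then 2 / pi\<^sup>2 else 1 / pi\<^sup>2)"

definition remainder_kernel :: "nat \<Rightarrow> real \<Rightarrow> real \<Rightarrow> real" where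
  "remainder_kernel N s t =
     min s t - (\<Sum>n\<le>N. 2 * sin (freq n * s) * sin (freq n * t) / (freq n)\<^sup>2)"

lemma remainder_kernel_eq: "remainder_kernel N s t = defect N \<bar>s - t\<bar> - defect N (s + t)"
proof -
  have "cos (freq n * \<bar>s - t\<bar>) = cos (freq n * (s - t))" for n
    by (simp add: abs_if) (metis cos_minus minus_diff_eq mult_minus_right)
  then have "2 * sin (freq n * s) * sin (freq n * t) = cos (freq n * \<bar>s - t\<bar>) - cos (freq n * (s + t))" for n
    by (simp add: right_diff_distrib distrib_left cos_diff cos_add)
  then have "(\<Sum>n\<le>N. 2 * sin (freq n * s) * sin (freq n * t) / (freq n)\<^sup>2) =
      (\<Sum>n\<le>N. cos (freq n * \<bar>s - t\<bar>) / (freq n)\<^sup>2) - (\<Sum>n\<le>N. cos (freq n * (s + t)) / (freq n)\<^sup>2)"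
    by (simp only: diff_divide_distrib sum_subtractf)
  moreover have "min s t = (1 - \<bar>s - t\<bar>) / 2 - (1 - (s + t)) / 2"
    by (simp add: min_def abs_if field_simps)
  ultimately show ?thesis
    unfolding remainder_kernel_def defect_def by linarith
qed

lemma scaled_remainder_kernel_tendsto:
  assumes "s \<in> {0..1}" "t \<in> {0..1}"
  shows "(\<lambda>N. real N * remainder_kernel N s t) \<longlonglongrightarrow> (if s = t then limit_variance t else 0)"
proof -
  have two: "(\<lambda>N. real N * defect N 2) \<longlonglongrightarrow> - (1 / pi\<^sup>2)"
    using tendsto_minus[OF scaled_defect_0] defect_reflect[of _ 0] by simp
  have *: "(\<lambda>N. real N * remainder_kernel N s t) \<longlonglongrightarrow> a - b"
    if "(\<lambda>N. real N * defect N \<bar>s - t\<bar>) \<longlonglongrightarrow> a" "(\<lambda>N. real N * defect N (s + t)) \<longlonglongrightarrow> b" for a b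
    using tendsto_diff[OF that] by (simp add: remainder_kernel_eq right_diff_distrib)
  consider "s \<noteq> t" | "s = t" "t = 0" | "s = t" "t = 1" | "s = t" "t \<noteq> 0" "t \<noteq> 1" by blast
  then show ?thesis
  proof cases
    case 1
    with *[OF scaled_defect_interior scaled_defect_interior] assms show ?thesis by auto
  next
    case 2
    with *[of "1/pi\<^sup>2" "1/pi\<^sup>2"] scaled_defect_0 show ?thesis by (simp add: limit_variance_def)
  next
    case 3
    with *[of "1/pi\<^sup>2" "-(1/pi\<^sup>2)"] scaled_defect_0 two show ?thesis by (simp add: limit_variance_def)
  next
    case 4
    with *[of "1/pi\<^sup>2" 0] scaled_defect_0 scaled_defect_interior[of "s + t"] assms
    show ?thesis by (simp add: limit_variance_def)
  qed
qed

section \<open>Covariance of the remainders\<close>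

text \<open>The inner product of \<open>L\<^sup>2[0,1]\<close> as a relation between two functions and its value, which contains the
integrability of the product.\<close>

abbreviation unit_inner :: "(real \<Rightarrow> real) \<Rightarrow> (real \<Rightarrow> real) \<Rightarrow> real \<Rightarrow> bool" where
  "unit_inner f g v \<equiv> has_bochner_integral lborel (\<lambda>r. indicator {0..1} r * (f r * g r)) v"

lemma unit_inner_commute: "unit_inner f g v \<Longrightarrow> unit_inner g f v"
  by (simp add: mult.commute)

lemma unit_inner_sum:
  assumes "finite A" "\<And>i. i \<in> A \<Longrightarrow> unit_inner (f i) g (v i)"
  shows "unit_inner (\<lambda>r. \<Sum>i\<in>A. a i * f i r) g (\<Sum>i\<in>A. a i * v i)"
proof -
  have "has_bochner_integral lborel (\<lambda>r. \<Sum>i\<in>A. a i * (indicator {0..1} r * (f i r * g r))) (\<Sum>i\<in>A. a i * v i)"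
    using assms by (intro has_bochner_integral_sum has_bochner_integral_mult_right) auto
  then show ?thesis by (simp add: sum_distrib_left sum_distrib_right mult_ac)
qed

lemma unit_inner_diff:
  assumes "unit_inner f h v" "unit_inner g h w"
  shows "unit_inner (\<lambda>r. f r - g r) h (v - w)"
  using has_bochner_integral_diff[OF assms] by (simp add: algebra_simps)

lemma unit_norm_sq_inner: "unit_inner f f v \<Longrightarrow> unit_norm_sq f = v"
  unfolding unit_norm_sq_def set_lebesgue_integral_def
  by (simp add: power2_eq_square has_bochner_integral_integral_eq)

lemma unit_inner_cos_cos:
  "unit_inner (\<lambda>r. cos (freq n * r)) (\<lambda>r. cos (freq m * r)) (if n = m then 1 / 2 else 0)"
proof (cases "n = m")
  case True
  define F where "F r = r / 2 + sin (2 * freq n * r) / (4 * freq n)" for r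
  have "has_bochner_integral lborel (\<lambda>r. cos (freq n * r) * cos (freq n * r) * indicator {0..1} r) (F 1 - F 0)"
  proof (rule has_bochner_integral_FTC_Icc_real)
    fix r
    have "cos (freq n * r) * cos (freq n * r) = 1 / 2 + cos (2 * freq n * r) / 2"
      using cos_double_cos[of "freq n * r"] by (simp add: power2_eq_square field_simps)
    then show "DERIV F r :> cos (freq n * r) * cos (freq n * r)"
      unfolding F_def using freq_pos[of n]
      by (auto intro!: derivative_eq_intros)
  qed auto
  moreover have "F 1 - F 0 = 1 / 2"
    using sin_double[of "freq n"] by (simp add: F_def cos_freq)
  ultimately show ?thesis using True by (simp add: mult_ac)
next
  case False
  define d e where "d = freq n - freq m" and "e = freq n + freq m"
  have d: "d = of_int (int n - int m) * pi" by (simp add: d_def freq_def algebra_simps)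
  have e: "e = of_int (int n + int m + 1) * pi" by (simp add: e_def freq_def algebra_simps)
  have nz: "d \<noteq> 0" "e \<noteq> 0"
    using False freq_pos[of n] freq_pos[of m] by (simp_all add: d_def e_def, simp add: freq_def)
  define F where "F r = sin (d * r) / (2 * d) + sin (e * r) / (2 * e)" for r
  have "has_bochner_integral lborel (\<lambda>r. cos (freq n * r) * cos (freq m * r) * indicator {0..1} r) (F 1 - F 0)"
  proof (rule has_bochner_integral_FTC_Icc_real)
    fix r
    have "cos (freq n * r) * cos (freq m * r) = cos (d * r) / 2 + cos (e * r) / 2"
      by (simp add: d_def e_def left_diff_distrib distrib_right cos_add cos_diff add_divide_distrib diff_divide_distrib)
    then show "DERIV F r :> cos (freq n * r) * cos (freq m * r)"
      unfolding F_def using nz by (auto intro!: derivative_eq_intros)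
  qed auto
  moreover have "F 1 - F 0 = 0"
  proof -
    have "sin d = 0" "sin e = 0" unfolding sin_zero_iff_int2 using d e by blast+
    then show ?thesis by (simp add: F_def)
  qed
  ultimately show ?thesis using False by (simp add: mult_ac)
qed

lemma unit_inner_indicator_cos:
  assumes "t \<in> {0..1}"
  shows "unit_inner (indicator {0<..t}) (\<lambda>r. cos (freq n * r)) (sin (freq n * t) / freq n)"
proof -
  have "has_bochner_integral lborel (\<lambda>r. cos (freq n * r) * indicator {0..t} r)
      (sin (freq n * t) / freq n - sin (freq n * 0) / freq n)"
    using assms freq_pos[of n] by (intro has_bochner_integral_FTC_Icc_real) (auto intro!: derivative_eq_intros)
  moreover have "AE r in lborel. cos (freq n * r) * indicator {0..t} r =
      indicator {0..1} r * (indicator {0<..t} r * cos (freq n * r))"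
    using AE_lborel_singleton[of "0::real"] by eventually_elim (use assms in \<open>auto split: split_indicator\<close>)
  ultimately show ?thesis
    by (subst has_bochner_integral_cong_AE[symmetric]) auto
qed

lemma unit_inner_indicator_indicator:
  assumes "s \<in> {0..1}" "t \<in> {0..1}"
  shows "unit_inner (indicator {0<..s}) (indicator {0<..t}) (min s t)"
proof -
  have "has_bochner_integral lborel (indicator {0<..min s t} :: real \<Rightarrow> real) (measure lborel {0<..min s t})"
    using assms by (intro has_bochner_integral_real_indicator) auto
  also have "measure lborel {0<..min s t} = min s t" using assms by simp
  also have "(indicator {0<..min s t} :: real \<Rightarrow> real) = (\<lambda>r. indicator {0..1} r * (indicator {0<..s} r * indicator {0<..t} r))"
    using assms by (auto split: split_indicator)
  finally show ?thesis .
qed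

definition remainder :: "nat \<Rightarrow> real \<Rightarrow> real \<Rightarrow> real" where
  "remainder N t r = indicator {0<..t} r - (\<Sum>n\<le>N. 2 * sin (freq n * t) / freq n * cos (freq n * r))"

text \<open>With \<open>P x\<close> the partial sum for the indicator of \<open>(0, x]\<close>, the inner products of \<open>P s\<close> with the indicator of \<open>(0, t]\<close>,
of \<open>P t\<close> with the indicator of \<open>(0, s]\<close>, and of \<open>P s\<close> with \<open>P t\<close> are all equal to the same sum \<open>Q\<close>, because \<open>P\<close>
is an orthogonal projection.\<close>

lemma unit_inner_remainder:
  assumes s: "s \<in> {0..1}" and t: "t \<in> {0..1}"
  shows "unit_inner (remainder N s) (remainder N t) (remainder_kernel N s t)"
proof -
  define c where "c n x = 2 * sin (freq n * x) / freq n" for n x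
  define P where "P x r = (\<Sum>n\<le>N. c n x * cos (freq n * r))" for x r
  define Q where "Q = (\<Sum>n\<le>N. 2 * sin (freq n * s) * sin (freq n * t) / (freq n)\<^sup>2)"
  have ip: "unit_inner (P x) (indicator {0<..y}) (\<Sum>n\<le>N. c n x * (sin (freq n * y) / freq n))" if "y \<in> {0..1}" for x y
    unfolding P_def using that
    by (intro unit_inner_sum unit_inner_commute[OF unit_inner_indicator_cos]) auto
  have pc: "unit_inner (P x) (\<lambda>r. cos (freq m * r)) (c m x / 2)" if "m \<le> N" for x m
  proof -
    have "unit_inner (P x) (\<lambda>r. cos (freq m * r)) (\<Sum>n\<le>N. c n x * (if n = m then 1 / 2 else 0))"
      unfolding P_def by (intro unit_inner_sum unit_inner_cos_cos) auto
    also have "(\<Sum>n\<le>N. c n x * (if n = m then 1 / 2 else 0)) = c m x / 2"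
      using that by (simp add: if_distrib[of "\<lambda>u. _ * u"] sum.delta cong: if_cong)
    finally show ?thesis .
  qed
  have pp: "unit_inner (P s) (P t) (\<Sum>n\<le>N. c n s * (c n t / 2))"
    unfolding P_def[of s] by (intro unit_inner_sum unit_inner_commute[OF pc]) auto
  have Q: "(\<Sum>n\<le>N. c n s * (sin (freq n * t) / freq n)) = Q"
      "(\<Sum>n\<le>N. c n t * (sin (freq n * s) / freq n)) = Q" "(\<Sum>n\<le>N. c n s * (c n t / 2)) = Q"
    unfolding Q_def c_def by (simp_all add: power2_eq_square mult_ac)
  have "unit_inner (indicator {0<..s}) (\<lambda>r. indicator {0<..t} r - P t r) (min s t - Q)"
    using unit_inner_diff[OF unit_inner_commute[OF unit_inner_indicator_indicator[OF s t]] ip[OF s, of t]]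
    unfolding Q by (rule unit_inner_commute)
  moreover have "unit_inner (P s) (\<lambda>r. indicator {0<..t} r - P t r) (Q - Q)"
    using unit_inner_diff[OF unit_inner_commute[OF ip[OF t, of s]] unit_inner_commute[OF pp]]
    unfolding Q by (rule unit_inner_commute)
  ultimately have "unit_inner (\<lambda>r. indicator {0<..s} r - P s r) (\<lambda>r. indicator {0<..t} r - P t r) (min s t - Q - (Q - Q))"
    by (rule unit_inner_diff)
  moreover have "remainder N x = (\<lambda>r. indicator {0<..x} r - P x r)" for x
    by (simp add: fun_eq_iff remainder_def P_def c_def)
  ultimately show ?thesis by (simp add: remainder_kernel_def Q_def)
qed

section \<open>Convergence of the fluctuations\<close>

text \<open>Collects the terms of a sum whose points \<open>t i\<close> coincide: the times of a finite dimensional marginal may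
repeat, while independence of the limit refers to distinct times.\<close>

lemma sum_regroup_by_value:
  fixes \<theta> :: "nat \<Rightarrow> real"
  shows "(\<Sum>i<k. \<theta> i * h (t i)) = (\<Sum>x\<in>t ` {..<k}. (\<Sum>i | i < k \<and> t i = x. \<theta> i) * h x)"
proof -
  have "(\<Sum>i<k. \<theta> i * h (t i)) = (\<Sum>x\<in>t ` {..<k}. \<Sum>i\<in>{i. i \<in> {..<k} \<and> t i = x}. \<theta> i * h (t i))"
    by (rule sum.image_gen) simp
  also have "\<dots> = (\<Sum>x\<in>t ` {..<k}. (\<Sum>i | i < k \<and> t i = x. \<theta> i) * h x)"
    by (intro sum.cong refl) (simp add: sum_distrib_right)
  finally show ?thesis .
qed

text \<open>The Wiener integral of the indicator of \<open>(0, t]\<close> is \<open>B t - B 0\<close>, which agrees with \<open>B t\<close> only almost surely.\<close>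

lemma (in brownian_motion) has_wiener_integral_fluctuation:
  assumes t: "t \<in> {0..1}"
  obtains J where "has_wiener_integral M B (remainder N t) J"
    "AE \<omega> in M. fluctuation M B N t \<omega> = sqrt (real N) * J \<omega>"
    "fluctuation M B N t \<in> borel_measurable M"
proof -
  define W where "W n = wiener_integral M B (\<lambda>r. cos (freq n * r))" for n
  have W: "has_wiener_integral M B (\<lambda>r. cos (freq n * r)) (W n)" for n
    unfolding W_def by (rule has_wiener_integral_cos)
  have [measurable]: "W n \<in> borel_measurable M" for n
    using W[of n] by (simp add: has_wiener_integral_def)
  have [measurable]: "B t \<in> borel_measurable M" using t by (rule measurable_B)
  define c where "c n = 2 * sin (freq n * t) / freq n" for n
  define J where "J \<omega> = (B t \<omega> - B 0 \<omega>) - (\<Sum>n\<le>N. c n * W n \<omega>)" for \<omega>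
  have fluct: "fluctuation M B N t \<omega> = sqrt (real N) * (B t \<omega> - (\<Sum>n\<le>N. c n * W n \<omega>))" for \<omega>
    by (simp add: fluctuation_def c_def W_def freq_def atLeast0AtMost)
  have "has_wiener_integral M B (step_eval [(1, 0, t)]) (step_integral B [(1, 0, t)])"
    using t by (intro has_wiener_integral_step) (simp add: valid_step_def)
  moreover have "has_wiener_integral M B (\<lambda>r. \<Sum>n\<le>N. c n * cos (freq n * r)) (\<lambda>\<omega>. \<Sum>n\<le>N. c n * W n \<omega>)"
    using W by (intro has_wiener_integral_sum) auto
  ultimately have "has_wiener_integral M B
      (\<lambda>r. 1 * step_eval [(1, 0, t)] r + (-1) * (\<Sum>n\<le>N. c n * cos (freq n * r)))
      (\<lambda>\<omega>. 1 * step_integral B [(1, 0, t)] \<omega> + (-1) * (\<Sum>n\<le>N. c n * W n \<omega>))"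
    by (rule has_wiener_integral_lincomb)
  moreover have "(\<lambda>r. 1 * step_eval [(1, 0, t)] r + (-1) * (\<Sum>n\<le>N. c n * cos (freq n * r))) = remainder N t"
    by (simp add: fun_eq_iff remainder_def c_def step_eval_def)
  moreover have "(\<lambda>\<omega>. 1 * step_integral B [(1, 0, t)] \<omega> + (-1) * (\<Sum>n\<le>N. c n * W n \<omega>)) = J"
    by (simp add: fun_eq_iff J_def step_integral_def)
  ultimately have "has_wiener_integral M B (remainder N t) J" by simp
  moreover have "AE \<omega> in M. fluctuation M B N t \<omega> = sqrt (real N) * J \<omega>"
    using start by eventually_elim (simp add: fluct J_def)
  moreover have "fluctuation M B N t \<in> borel_measurable M"
    unfolding fluct[abs_def] by measurable
  ultimately show ?thesis by (rule that)
qed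

lemma (in brownian_motion) expectation_cos_fluctuation:
  fixes t :: "nat \<Rightarrow> real"
  assumes t: "t \<in> {..<k} \<rightarrow> {0..1}"
  shows "expectation (\<lambda>\<omega>. cos ((\<Sum>i<k. \<theta> i * fluctuation M B N (t i) \<omega>) + c)) =
    cos c * exp (- ((\<Sum>i<k. \<Sum>j<k. \<theta> i * \<theta> j * (real N * remainder_kernel N (t i) (t j))) / 2))"
proof -
  have "\<exists>J. has_wiener_integral M B (remainder N (t i)) J \<and>
      (AE \<omega> in M. fluctuation M B N (t i) \<omega> = sqrt (real N) * J \<omega>)" if "i < k" for i
    using has_wiener_integral_fluctuation[of "t i" N] t that by (metis Pi_mem lessThan_iff)
  then obtain J where J: "\<And>i. i < k \<Longrightarrow> has_wiener_integral M B (remainder N (t i)) (J i)"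
    and ae: "\<And>i. i < k \<Longrightarrow> AE \<omega> in M. fluctuation M B N (t i) \<omega> = sqrt (real N) * J i \<omega>"
    by metis
  have [measurable]: "fluctuation M B N (t i) \<in> borel_measurable M" if "i < k" for i
    using has_wiener_integral_fluctuation[of "t i" N] t that by (metis Pi_mem lessThan_iff)
  have [measurable]: "J i \<in> borel_measurable M" if "i < k" for i
    using J[OF that] by (simp add: has_wiener_integral_def)
  define a where "a i = \<theta> i * sqrt (real N)" for i
  define g where "g r = (\<Sum>i<k. a i * remainder N (t i) r)" for r
  have wiener: "has_wiener_integral M B g (\<lambda>\<omega>. \<Sum>i<k. a i * J i \<omega>)"
    unfolding g_def using J by (intro has_wiener_integral_sum) auto
  have "unit_inner g (remainder N (t j)) (\<Sum>i<k. a i * remainder_kernel N (t i) (t j))" if "j < k" for j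
    unfolding g_def using t that by (intro unit_inner_sum unit_inner_remainder) (auto simp: Pi_iff)
  then have "unit_inner (remainder N (t j)) g (\<Sum>i<k. a i * remainder_kernel N (t i) (t j))" if "j < k" for j
    using that unit_inner_commute by blast
  then have "unit_inner g g (\<Sum>j<k. a j * (\<Sum>i<k. a i * remainder_kernel N (t i) (t j)))"
    by (subst (1) g_def) (intro unit_inner_sum, auto)
  then have "unit_norm_sq g = (\<Sum>j<k. a j * (\<Sum>i<k. a i * remainder_kernel N (t i) (t j)))"
    by (rule unit_norm_sq_inner)
  also have "\<dots> = (\<Sum>i<k. \<Sum>j<k. a j * (a i * remainder_kernel N (t i) (t j)))"
    unfolding sum_distrib_left by (rule sum.swap)
  also have "\<dots> = (\<Sum>i<k. \<Sum>j<k. \<theta> i * \<theta> j * (real N * remainder_kernel N (t i) (t j)))"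
  proof (intro sum.cong refl)
    fix i j
    have "a j * (a i * K) = \<theta> i * \<theta> j * (sqrt (real N) * sqrt (real N) * K)" for K
      by (simp only: a_def mult_ac)
    then show "a j * (a i * remainder_kernel N (t i) (t j)) = \<theta> i * \<theta> j * (real N * remainder_kernel N (t i) (t j))"
      by simp
  qed
  finally have norm: "unit_norm_sq g = (\<Sum>i<k. \<Sum>j<k. \<theta> i * \<theta> j * (real N * remainder_kernel N (t i) (t j)))" .
  have "AE \<omega> in M. \<forall>i\<in>{..<k}. fluctuation M B N (t i) \<omega> = sqrt (real N) * J i \<omega>"
    using ae by (intro AE_finite_allI) auto
  then have "expectation (\<lambda>\<omega>. cos ((\<Sum>i<k. \<theta> i * fluctuation M B N (t i) \<omega>) + c)) =
      expectation (\<lambda>\<omega>. cos ((\<Sum>i<k. a i * J i \<omega>) + c))"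
    by (intro integral_cong_AE) (auto simp: a_def mult_ac elim!: eventually_mono)
  also have "\<dots> = cos c * exp (- (unit_norm_sq g / 2))"
    by (rule expectation_cos_wiener[OF wiener])
  finally show ?thesis by (simp only: norm)
qed

lemma expectation_cos_independent_limit:
  fixes t :: "nat \<Rightarrow> real"
  assumes "prob_space M'" and ind: "prob_space.indep_vars M' (\<lambda>_. borel) F {0..1}"
    and gauss: "\<And>x. x \<in> {0..1} \<Longrightarrow> gaussian_rv M' (F x) 0 (v x)"
    and t: "t \<in> {..<k} \<rightarrow> {0..1}"
  shows "(\<integral>\<omega>. cos ((\<Sum>i<k. \<theta> i * F (t i) \<omega>) + c) \<partial>M') =
    cos c * exp (- ((\<Sum>i<k. \<Sum>j<k. \<theta> i * \<theta> j * (if t i = t j then v (t j) else 0)) / 2))"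
proof -
  interpret prob_space M' by fact
  define A where "A = t ` {..<k}"
  define a where "a x = (\<Sum>i | i < k \<and> t i = x. \<theta> i)" for x
  have A: "finite A" "A \<subseteq> {0..1}" using t by (auto simp: A_def)
  have "(\<Sum>i<k. \<theta> i * F (t i) \<omega>) = (\<Sum>x\<in>A. a x * F x \<omega>)" for \<omega>
    unfolding A_def a_def by (rule sum_regroup_by_value)
  then have "(\<integral>\<omega>. cos ((\<Sum>i<k. \<theta> i * F (t i) \<omega>) + c) \<partial>M') = expectation (\<lambda>\<omega>. cos ((\<Sum>x\<in>A. a x * F x \<omega>) + c))"
    by simp
  also have "\<dots> = cos c * exp (- ((\<Sum>x\<in>A. (a x)\<^sup>2 * v x) / 2))"
    using A gauss by (intro expectation_cos_gaussian_combination indep_vars_subset[OF ind]) auto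
  also have "(\<Sum>x\<in>A. (a x)\<^sup>2 * v x) = (\<Sum>x\<in>A. a x * (a x * v x))"
    by (simp add: power2_eq_square mult_ac)
  also have "\<dots> = (\<Sum>i<k. \<theta> i * (a (t i) * v (t i)))"
    unfolding A_def a_def by (rule sum_regroup_by_value[symmetric])
  also have "\<dots> = (\<Sum>i<k. \<Sum>j<k. \<theta> i * \<theta> j * (if t i = t j then v (t j) else 0))"
  proof (rule sum.cong[OF refl])
    fix i
    have "a (t i) = (\<Sum>j<k. if t j = t i then \<theta> j else 0)"
      unfolding a_def by (simp add: sum.inter_filter[symmetric])
    then have "\<theta> i * (a (t i) * v (t i)) = (\<Sum>j<k. \<theta> i * ((if t j = t i then \<theta> j else 0) * v (t i)))"
      by (simp only: sum_distrib_left sum_distrib_right)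
    also have "\<dots> = (\<Sum>j<k. \<theta> i * \<theta> j * (if t i = t j then v (t j) else 0))"
      by (intro sum.cong refl) auto
    finally show "\<theta> i * (a (t i) * v (t i)) = (\<Sum>j<k. \<theta> i * \<theta> j * (if t i = t j then v (t j) else 0))" .
  qed
  finally show ?thesis .
qed

theorem theorem1p2:
  fixes M :: "'a measure" and B :: "real \<Rightarrow> 'a \<Rightarrow> real"
    and M' :: "'b measure" and F :: "real \<Rightarrow> 'b \<Rightarrow> real"
  assumes "brownian_motion M B"
    and "prob_space M'"
    and "prob_space.indep_vars M' (\<lambda>_. borel) F {0..1}"
    and "\<And>t. t \<in> {0<..<1} \<Longrightarrow> gaussian_rv M' (F t) 0 (1 / pi\<^sup>2)"
    and "gaussian_rv M' (F 1) 0 (2 / pi\<^sup>2)"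
    and "gaussian_rv M' (F 0) 0 0"
  shows "converges_fdd {0..1} M (fluctuation M B) M' F"
proof -
  interpret brownian_motion M B by fact
  have gauss: "gaussian_rv M' (F x) 0 (limit_variance x)" if "x \<in> {0..1}" for x
  proof -
    from that consider "x = 0" | "x = 1" | "x \<in> {0<..<1}" by fastforce
    then show ?thesis using assms(4-6) by cases (auto simp: limit_variance_def)
  qed
  show ?thesis
    unfolding converges_fdd_def
  proof (intro allI impI)
    fix k :: nat and t :: "nat \<Rightarrow> real" assume t: "t \<in> {..<k} \<rightarrow> {0..1}"
    show "converges_in_distribution k M (\<lambda>N \<omega>. \<lambda>i\<in>{..<k}. fluctuation M B N (t i) \<omega>)
        M' (\<lambda>\<omega>. \<lambda>i\<in>{..<k}. F (t i) \<omega>)"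
    proof (rule converges_in_distribution_of_waves[OF prob_space_axioms assms(2)])
      show "fluctuation M B N (t i) \<in> borel_measurable M" if "i < k" for N i
        using has_wiener_integral_fluctuation[of "t i" N] t that by (metis Pi_mem lessThan_iff)
      show "F (t i) \<in> borel_measurable M'" if "i < k" for i
        using gauss[of "t i"] t that by (auto simp: gaussian_rv_def Pi_iff)
      show "(\<lambda>N. \<integral>\<omega>. cos ((\<Sum>i<k. \<theta> i * fluctuation M B N (t i) \<omega>) + c) \<partial>M)
          \<longlonglongrightarrow> (\<integral>\<omega>. cos ((\<Sum>i<k. \<theta> i * F (t i) \<omega>) + c) \<partial>M')" for \<theta> c
      proof -
        have "(\<integral>\<omega>. cos ((\<Sum>i<k. \<theta> i * F (t i) \<omega>) + c) \<partial>M') =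
            cos c * exp (- ((\<Sum>i<k. \<Sum>j<k. \<theta> i * \<theta> j * (if t i = t j then limit_variance (t j) else 0)) / 2))"
          by (rule expectation_cos_independent_limit[OF assms(2,3) gauss t])
        moreover have "(\<lambda>N. real N * remainder_kernel N (t i) (t j))
            \<longlonglongrightarrow> (if t i = t j then limit_variance (t j) else 0)" if "i \<in> {..<k}" "j \<in> {..<k}" for i j
          using t that by (intro scaled_remainder_kernel_tendsto) auto
        ultimately show ?thesis
          unfolding expectation_cos_fluctuation[OF t] by (auto intro!: tendsto_intros)
      qed
    qed
  qed
qed

end
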